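(* Let $n\ge 2$ and let $\tfrac12\le r_1,r_2,\ldots,r_{n-1}<1$ be constants. Define biased-permutation probabilities on $[n]$ by $p_{i,j}=r_i$ and $p_{j,i}=1-r_i$ for all $1\le i<j\le n$. Consider the Markov chain $\mathcal{M}_{inv}$ on $S_n$ with these $p_{i,j}$ (defined in the context). 1. If each $r_i>1/2$ (i.e. each $r_i$ is a constant strictly larger than $1/2$), then the mixing time of $\mathcal{M}_{inv}$ satisfies $\tau(\epsilon)=O(n^2\ln(n/\epsilon))$. 2. Otherwise, the mixing time of $\mathcal{M}_{inv}$ satisfies $\tau(\epsilon)=O(n^3\ln(n/\epsilon))$.
   Context: A permutation $\sigma\in S_n$ is written as the list $\sigma(1),\ldots,\sigma(n)$. Given probabilities $p_{i,j}\in[0,1]$ for $i\neq j$ in $[n]$ with $p_{j,i}=1-p_{i,j}$ and $p_{i,j}\ge 1/2$ for $i<j$, the target distribution is $\pi(\sigma)=Z^{-1}\prod_{a \text{ before } b \text{ in } \sigma} p_{a,b}$, with $Z$ the normalizing constant. The chain $\mathcal{M}_{inv}$: from $\sigma_t$, select an element $i\in[n]$ with probability $(n-i)/\binom{n}{2}$ and a bit $b\in\{-1,+1\}$ uniformly at random. If $b=+1$, let $j$ be the first element after $i$ in $\sigma_t$ with $j>i$ (if it exists); with probability $p_{j,i}/2=(1-r_i)/2$ obtain $\sigma_{t+1}$ by swapping the positions of $i$ and $j$. If $b=-1$, let $j$ be the last element before $i$ in $\sigma_t$ with $j>i$ (if it exists); with probability $p_{i,j}/2=r_i/2$ obtain $\sigma_{t+1}$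 by swapping $i$ and $j$. In all other cases $\sigma_{t+1}=\sigma_t$. Mixing time: for a chain with transition matrix $\mathcal{P}$ and stationary distribution $\pi$, $\|\mathcal{P}^t,\pi\|_{tv}=\max_x\frac12\sum_y|\mathcal{P}^t(x,y)-\pi(y)|$ and $\tau(\epsilon)=\min\{t:\|\mathcal{P}^{t'},\pi\|_{tv}\le\epsilon\ \forall t'\ge t\}$. The $O(\cdot)$ bounds are as $n\to\infty$ with constants not depending on $n$ or $\epsilon$.
   Formalization: Part 1 assumes all r_i ≥ 1/2+δ for a fixed δ>0, with the O-constant depending on δ (it fails if the r_i approach 1/2, e.g. r_i=1/2+1/(i+2)²); part 2 is for "otherwise" with any δ, so it covers all r_i in [1/2,1); ε ranges over 0<ε≤n, where ln(n/ε)≥0. *)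

theory Defs
  imports "HOL-Probability.Probability" "HOL-Combinatorics.Permutations"
begin

text \<open>A chain is given by its kernel: the \<open>(x, y)\<close> entry of the transition matrix is
  \<open>pmf (K x) y\<close>.\<close>

primrec kernel_power :: "('a \<Rightarrow> 'a pmf) \<Rightarrow> nat \<Rightarrow> 'a \<Rightarrow> 'a pmf" where
  "kernel_power K 0 x = return_pmf x"
| "kernel_power K (Suc t) x = bind_pmf (kernel_power K t x) K"

definition tv_distance :: "'a set \<Rightarrow> ('a \<Rightarrow> 'a pmf) \<Rightarrow> ('a \<Rightarrow> real) \<Rightarrow> nat \<Rightarrow> real" where
  "tv_distance S K \<pi> t =
     Max ((\<lambda>x. 1 / 2 * (\<Sum>y\<in>S. \<bar>pmf (kernel_power K t x) y - \<pi> y\<bar>)) ` S)"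

text \<open>The minimum is taken in \<^typ>\<open>enat\<close>, so that it is \<open>\<infinity>\<close> if the chain never gets within
  \<open>\<epsilon>\<close> of \<open>\<pi>\<close> for good.\<close>

definition mixing_time :: "'a set \<Rightarrow> ('a \<Rightarrow> 'a pmf) \<Rightarrow> ('a \<Rightarrow> real) \<Rightarrow> real \<Rightarrow> enat" where
  "mixing_time S K \<pi> \<epsilon> = Inf (enat ` {t. \<forall>t'\<ge>t. tv_distance S K \<pi> t' \<le> \<epsilon>})"

text \<open>A permutation \<open>\<sigma>\<close> stands for the list \<open>\<sigma> 1, \<dots>, \<sigma> n\<close>; the position of the element \<open>a\<close>
  in that list is \<open>inv \<sigma> a\<close>.\<close>

definition Sym :: "nat \<Rightarrow> (nat \<Rightarrow> nat) set" where
  "Sym n = {\<sigma>. \<sigma> permutes {1..n}}"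

definition weight :: "nat \<Rightarrow> (nat \<Rightarrow> nat \<Rightarrow> real) \<Rightarrow> (nat \<Rightarrow> nat) \<Rightarrow> real" where
  "weight n p \<sigma> =
     (\<Prod>(a, b) \<in> {(a, b). a \<in> {1..n} \<and> b \<in> {1..n} \<and> inv \<sigma> a < inv \<sigma> b}. p a b)"

definition target :: "nat \<Rightarrow> (nat \<Rightarrow> nat \<Rightarrow> real) \<Rightarrow> (nat \<Rightarrow> nat) \<Rightarrow> real" where
  "target n p \<sigma> = weight n p \<sigma> / (\<Sum>\<tau>\<in>Sym n. weight n p \<tau>)"

text \<open>The diagonal values are never used.\<close>

definition choose_prob :: "(nat \<Rightarrow> real) \<Rightarrow> nat \<Rightarrow> nat \<Rightarrow> real" where
  "choose_prob r i j = (if i < j then r i else 1 - r j)"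

definition next_larger :: "nat \<Rightarrow> (nat \<Rightarrow> nat) \<Rightarrow> nat \<Rightarrow> nat option" where
  "next_larger n \<sigma> i =
     (let K = {k \<in> {1..n}. inv \<sigma> i < k \<and> i < \<sigma> k}
      in if K = {} then None else Some (\<sigma> (Min K)))"

definition prev_larger :: "nat \<Rightarrow> (nat \<Rightarrow> nat) \<Rightarrow> nat \<Rightarrow> nat option" where
  "prev_larger n \<sigma> i =
     (let K = {k \<in> {1..n}. k < inv \<sigma> i \<and> i < \<sigma> k}
      in if K = {} then None else Some (\<sigma> (Max K)))"

definition select_pmf :: "nat \<Rightarrow> nat pmf" where
  "select_pmf n = embed_pmf (\<lambda>i. if i \<in> {1..n} then real (n - i) / real (n choose 2) else 0)"

lemma pmf_select_pmf:
  assumes "n \<ge> 2"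
  shows "pmf (select_pmf n) i = (if i \<in> {1..n} then real (n - i) / real (n choose 2) else 0)"
proof -
  let ?f = "\<lambda>i. if i \<in> {1..n} then real (n - i) / real (n choose 2) else 0"
  have "(\<Sum>i\<in>{1..n}. n - i) = (\<Sum>i<n. i)"
    by (rule sum.reindex_bij_witness[of _ "\<lambda>k. n - k" "\<lambda>i. n - i"]) auto
  also have "\<dots> = n choose 2"
    by (induction n) (auto simp: numeral_2_eq_2)
  finally have "(\<Sum>i\<in>{1..n}. real (n - i)) = real (n choose 2)"
    by (metis of_nat_sum)
  moreover have "real (n choose 2) > 0"
    using assms by simp
  ultimately have one: "(\<Sum>i\<in>{1..n}. ?f i) = 1"
    by (simp flip: sum_divide_distrib)
  have "(\<integral>\<^sup>+ i. ennreal (?f i) \<partial>count_space UNIV) = (\<Sum>i\<in>{1..n}. ennreal (?f i))"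
    by (rule nn_integral_count_space') auto
  also have "\<dots> = ennreal (\<Sum>i\<in>{1..n}. ?f i)"
    by (rule sum_ennreal) auto
  finally show ?thesis
    unfolding select_pmf_def one by (subst pmf_embed_pmf) auto
qed

text \<open>Swapping the positions of the elements \<open>i\<close> and \<open>j\<close> is \<open>Transposition.transpose i j \<circ> \<sigma>\<close>.\<close>

definition M_inv :: "nat \<Rightarrow> (nat \<Rightarrow> nat \<Rightarrow> real) \<Rightarrow> (nat \<Rightarrow> nat) \<Rightarrow> (nat \<Rightarrow> nat) pmf" where
  "M_inv n p \<sigma> =
     do {
       i \<leftarrow> select_pmf n;
       b \<leftarrow> pmf_of_set {-1, 1 :: int};
       case (if b = 1 then next_larger n \<sigma> i else prev_larger n \<sigma> i) of
         None \<Rightarrow> return_pmf \<sigma>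
       | Some j \<Rightarrow>
           do {
             accept \<leftarrow> bernoulli_pmf ((if b = 1 then p j i else p i j) / 2);
             return_pmf (if accept then Transposition.transpose i j \<circ> \<sigma> else \<sigma>)
           }
     }"

definition tau_inv :: "nat \<Rightarrow> (nat \<Rightarrow> nat \<Rightarrow> real) \<Rightarrow> real \<Rightarrow> enat" where
  "tau_inv n p \<epsilon> = mixing_time (Sym n) (M_inv n p) (target n p) \<epsilon>"

end

theory Submission imports Defs begin

text \<open>
  Write \<open>x\<^sub>i\<close> for the number of elements larger than \<open>i\<close> that precede \<open>i\<close>. When the
  chain swaps \<open>i\<close> and \<open>j\<close>, all elements between them are smaller than \<open>i\<close>, so the swap changes
  \<open>x\<^sub>i\<close> by one and no other coordinate: in the coordinates \<open>(x\<^sub>1, \<dots>, x\<^sub>n)\<close>, which determine the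
  permutation, the chain is a product of lazy walks on \<open>{0..n - i}\<close>, each chosen with probability
  proportional to its length. Run two copies with the same choices. If the edge between \<open>k - 1\<close>
  and \<open>k\<close> is given the length \<open>w\<^sub>k \<ge> 1\<close>, the distance in coordinate \<open>i\<close> contracts in expectation by
  the factor \<open>1 - c / 4\<close> whenever \<open>i\<close> is chosen, provided that
  \<open>r\<^sub>i w\<^sub>k\<^sub>-\<^sub>1 + (1 - r\<^sub>i) w\<^sub>k\<^sub>+\<^sub>1 \<le> (1 - c) w\<^sub>k\<close>. For \<open>r\<^sub>i \<ge> 1/2 + \<delta>\<close> the geometric weights
  \<open>w\<^sub>k = (1 + \<delta>)\<^sup>k\<close> give a constant \<open>c\<close>; for \<open>r\<^sub>i \<ge> 1/2\<close> an increasing concave quadratic gives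
  \<open>c\<close> of order \<open>(n - i)\<^sup>-\<^sup>2\<close>.
\<close>

section \<open>Markov chains and couplings\<close>

locale markov_chain =
  fixes S :: "'a set" and K :: "'a \<Rightarrow> 'a pmf"
  assumes set_kernel: "x \<in> S \<Longrightarrow> set_pmf (K x) \<subseteq> S"
begin

lemma set_kernel_power: "x \<in> S \<Longrightarrow> set_pmf (kernel_power K t x) \<subseteq> S"
  using set_kernel by (induction t) (auto; blast)+

lemma map_kernel_power:
  assumes x: "x \<in> S" and map_kernel: "\<And>x. x \<in> S \<Longrightarrow> map_pmf f (K x) = L (f x)"
  shows "map_pmf f (kernel_power K t x) = kernel_power L t (f x)"
proof (induction t)
  case (Suc t)
  have "map_pmf f (kernel_power K (Suc t) x) = bind_pmf (kernel_power K t x) (\<lambda>z. map_pmf f (K z))"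
    by (simp add: map_bind_pmf)
  also have "\<dots> = bind_pmf (kernel_power K t x) (\<lambda>z. L (f z))"
    using set_kernel_power[OF x] map_kernel by (intro bind_pmf_cong) blast+
  also have "\<dots> = bind_pmf (map_pmf f (kernel_power K t x)) L"
    by (simp add: bind_map_pmf)
  finally show ?case
    using Suc.IH by simp
qed simp

end

locale finite_markov_chain = markov_chain +
  assumes finite_states: "finite S"
begin

lemma finite_set_kernel_power: "x \<in> S \<Longrightarrow> finite (set_pmf (kernel_power K t x))"
  using set_kernel_power finite_states finite_subset by blast

lemma expectation_kernel_power:
  fixes f :: "'a \<Rightarrow> real"
  assumes "x \<in> S"
  shows "measure_pmf.expectation (kernel_power K t x) f = (\<Sum>z\<in>S. pmf (kernel_power K t x) z * f z)"
  using set_kernel_power[OF assms] finite_states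
  by (subst integral_measure_pmf[of S]) auto

lemma pmf_kernel_power_Suc:
  assumes "x \<in> S"
  shows "pmf (kernel_power K (Suc t) x) y = (\<Sum>z\<in>S. pmf (kernel_power K t x) z * pmf (K z) y)"
  by (simp add: pmf_bind expectation_kernel_power[OF assms])

lemma expectation_kernel_power_le:
  fixes d :: "'a \<Rightarrow> real"
  assumes x: "x \<in> S" and "0 \<le> \<rho>"
    and contraction: "\<And>z. z \<in> S \<Longrightarrow> measure_pmf.expectation (K z) d \<le> \<rho> * d z"
  shows "measure_pmf.expectation (kernel_power K t x) d \<le> \<rho> ^ t * d x"
proof (induction t)
  case (Suc t)
  have "measure_pmf.expectation (kernel_power K (Suc t) x) d
      = (\<Sum>z\<in>S. pmf (kernel_power K t x) z * measure_pmf.expectation (K z) d)"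
    unfolding kernel_power.simps real_scaleR_def[symmetric]
    by (intro pmf_expectation_bind set_kernel_power x)
      (use set_kernel finite_states finite_subset in blast)+
  also have "\<dots> \<le> (\<Sum>z\<in>S. pmf (kernel_power K t x) z * (\<rho> * d z))"
    using contraction by (intro sum_mono mult_left_mono) auto
  also have "\<dots> = \<rho> * measure_pmf.expectation (kernel_power K t x) d"
    by (simp add: expectation_kernel_power[OF x] sum_distrib_left mult.left_commute)
  also have "\<dots> \<le> \<rho> * (\<rho> ^ t * d x)"
    using Suc.IH \<open>0 \<le> \<rho>\<close> by (rule mult_left_mono)
  finally show ?case
    by (simp add: mult.assoc)
qed simp

text \<open>Markov's inequality for \<open>\<Sum>i\<in>I. d i\<close>, which is at least \<open>1\<close> on \<open>A\<close>.\<close>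

lemma prob_kernel_power_le_sum:
  fixes d :: "'i \<Rightarrow> 'a \<Rightarrow> real"
  assumes x: "x \<in> S" and "finite I"
    and \<rho>: "\<And>i. i \<in> I \<Longrightarrow> 0 \<le> \<rho> i" and nonneg: "\<And>i z. i \<in> I \<Longrightarrow> 0 \<le> d i z"
    and contraction: "\<And>i z. \<lbrakk>i \<in> I; z \<in> S\<rbrakk> \<Longrightarrow> measure_pmf.expectation (K z) (d i) \<le> \<rho> i * d i z"
    and ge_1: "\<And>z. z \<in> S \<inter> A \<Longrightarrow> \<exists>i\<in>I. 1 \<le> d i z"
  shows "measure_pmf.prob (kernel_power K t x) A \<le> (\<Sum>i\<in>I. \<rho> i ^ t * d i x)"
proof -
  let ?P = "kernel_power K t x"
  have "indicator A z \<le> (\<Sum>i\<in>I. d i z)" if z: "z \<in> S" for z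
  proof (cases "z \<in> A")
    case True
    then obtain i where i: "i \<in> I" "1 \<le> d i z"
      using ge_1 z by blast
    have "d i z \<le> (\<Sum>i\<in>I. d i z)"
      using i(1) nonneg \<open>finite I\<close> by (intro member_le_sum) auto
    then show ?thesis
      using True i(2) by simp
  qed (simp add: nonneg sum_nonneg)
  then have "measure_pmf.expectation ?P (indicator A)
      \<le> measure_pmf.expectation ?P (\<lambda>z. \<Sum>i\<in>I. d i z)"
    unfolding expectation_kernel_power[OF x] by (intro sum_mono mult_left_mono) auto
  also have "\<dots> = (\<Sum>i\<in>I. measure_pmf.expectation ?P (d i))"
    by (intro Bochner_Integration.integral_sum integrable_measure_pmf_finite
        finite_set_kernel_power x)
  also have "\<dots> \<le> (\<Sum>i\<in>I. \<rho> i ^ t * d i x)"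
    by (intro sum_mono expectation_kernel_power_le x \<rho> contraction)
  finally show ?thesis
    by simp
qed

definition stationary :: "('a \<Rightarrow> real) \<Rightarrow> bool" where
  "stationary \<pi> \<longleftrightarrow> (\<forall>y\<in>S. (\<Sum>x\<in>S. \<pi> x * pmf (K x) y) = \<pi> y)"

lemma stationary_if_reversible:
  assumes reversible: "\<And>x y. \<lbrakk>x \<in> S; y \<in> S\<rbrakk> \<Longrightarrow> \<pi> x * pmf (K x) y = \<pi> y * pmf (K y) x"
  shows "stationary \<pi>"
  unfolding stationary_def
proof
  fix y assume y: "y \<in> S"
  then have "(\<Sum>x\<in>S. \<pi> x * pmf (K x) y) = (\<Sum>x\<in>S. \<pi> y * pmf (K y) x)"
    by (intro sum.cong reversible) auto
  also have "\<dots> = \<pi> y"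
    using sum_pmf_eq_1[OF finite_states set_kernel[OF y]] by (simp flip: sum_distrib_left)
  finally show "(\<Sum>x\<in>S. \<pi> x * pmf (K x) y) = \<pi> y" .
qed

lemma stationary_kernel_power:
  assumes "stationary \<pi>" "y \<in> S"
  shows "(\<Sum>x\<in>S. \<pi> x * pmf (kernel_power K t x) y) = \<pi> y"
  using \<open>y \<in> S\<close>
proof (induction t arbitrary: y)
  case 0
  have "(\<Sum>x\<in>S. \<pi> x * pmf (return_pmf x) y) = (\<Sum>x\<in>S. if x = y then \<pi> y else 0)"
    by (intro sum.cong) (auto simp: indicator_def)
  then show ?case
    using finite_states 0 by simp
next
  case (Suc t)
  have "(\<Sum>x\<in>S. \<pi> x * pmf (kernel_power K (Suc t) x) y)
      = (\<Sum>x\<in>S. \<Sum>z\<in>S. \<pi> x * pmf (kernel_power K t x) z * pmf (K z) y)"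
    by (simp add: pmf_kernel_power_Suc sum_distrib_left mult.assoc del: kernel_power.simps)
  also have "\<dots> = (\<Sum>z\<in>S. (\<Sum>x\<in>S. \<pi> x * pmf (kernel_power K t x) z) * pmf (K z) y)"
    by (subst sum.swap) (simp add: sum_distrib_right)
  also have "\<dots> = \<pi> y"
    using Suc assms(1) by (simp add: stationary_def)
  finally show ?case .
qed

lemma tv_distance_le_pairwise:
  assumes "S \<noteq> {}" "stationary \<pi>"
    and \<pi>: "\<And>x. x \<in> S \<Longrightarrow> 0 \<le> \<pi> x" "(\<Sum>x\<in>S. \<pi> x) = 1"
    and pairwise: "\<And>x y. \<lbrakk>x \<in> S; y \<in> S\<rbrakk> \<Longrightarrow>
      (\<Sum>z\<in>S. \<bar>pmf (kernel_power K t x) z - pmf (kernel_power K t y) z\<bar>) \<le> 2 * B"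
  shows "tv_distance S K \<pi> t \<le> B"
proof -
  let ?P = "\<lambda>x. pmf (kernel_power K t x)"
  have "1 / 2 * (\<Sum>z\<in>S. \<bar>?P x z - \<pi> z\<bar>) \<le> B" if x: "x \<in> S" for x
  proof -
    have "?P x z - \<pi> z = (\<Sum>y\<in>S. \<pi> y * (?P x z - ?P y z))" if z: "z \<in> S" for z
      using stationary_kernel_power[OF \<open>stationary \<pi>\<close> z, of t] \<pi>(2)
      by (simp add: right_diff_distrib sum_subtractf flip: sum_distrib_right)
    then have "(\<Sum>z\<in>S. \<bar>?P x z - \<pi> z\<bar>) = (\<Sum>z\<in>S. \<bar>\<Sum>y\<in>S. \<pi> y * (?P x z - ?P y z)\<bar>)"
      by simp
    also have "\<dots> \<le> (\<Sum>z\<in>S. \<Sum>y\<in>S. \<bar>\<pi> y * (?P x z - ?P y z)\<bar>)"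
      by (intro sum_mono sum_abs)
    also have "\<dots> = (\<Sum>y\<in>S. \<pi> y * (\<Sum>z\<in>S. \<bar>?P x z - ?P y z\<bar>))"
      using \<pi>(1) by (subst sum.swap) (simp add: abs_mult sum_distrib_left)
    also have "\<dots> \<le> (\<Sum>y\<in>S. \<pi> y * (2 * B))"
      using \<pi>(1) pairwise x by (intro sum_mono mult_left_mono) auto
    also have "\<dots> = 2 * B"
      using \<pi>(2) by (simp flip: sum_distrib_right)
    finally show ?thesis
      by simp
  qed
  then show ?thesis
    unfolding tv_distance_def using finite_states \<open>S \<noteq> {}\<close> by (subst Max_le_iff) blast+
qed

end

lemma pmf_map_eq_expectation:
  "pmf (map_pmf f p) y = measure_pmf.expectation p (\<lambda>x. indicator {y} (f x))"
  unfolding integral_map_pmf[symmetric] by (simp add: measure_pmf_single del: integral_map_pmf)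

lemma coupling_inequality:
  fixes C :: "('a \<times> 'a) pmf"
  assumes "finite S"
  shows "(\<Sum>z\<in>S. \<bar>pmf (map_pmf fst C) z - pmf (map_pmf snd C) z\<bar>)
    \<le> 2 * measure_pmf.prob C {p. fst p \<noteq> snd p}"
proof -
  let ?E = "measure_pmf.expectation C"
  define g :: "'a \<Rightarrow> 'a \<times> 'a \<Rightarrow> real"
    where "g z p = indicator {z} (fst p) - indicator {z} (snd p)" for z p
  have integrable: "integrable C (\<lambda>p. indicator {z} (f p) :: real)"
    for f :: "'a \<times> 'a \<Rightarrow> 'a" and z
    by (rule measure_pmf.integrable_const_bound[of _ 1]) auto
  then have integrable_g: "integrable C (g z)" for z
    unfolding g_def by (intro Bochner_Integration.integrable_diff)
  have "\<bar>pmf (map_pmf fst C) z - pmf (map_pmf snd C) z\<bar> \<le> ?E (\<lambda>p. \<bar>g z p\<bar>)" for z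
    unfolding pmf_map_eq_expectation g_def
      Bochner_Integration.integral_diff[OF integrable integrable, symmetric]
    by (rule integral_abs_bound)
  then have "(\<Sum>z\<in>S. \<bar>pmf (map_pmf fst C) z - pmf (map_pmf snd C) z\<bar>) \<le> (\<Sum>z\<in>S. ?E (\<lambda>p. \<bar>g z p\<bar>))"
    by (intro sum_mono)
  also have "\<dots> = ?E (\<lambda>p. \<Sum>z\<in>S. \<bar>g z p\<bar>)"
    using integrable_g by (intro Bochner_Integration.integral_sum[symmetric] integrable_abs)
  also have "\<dots> \<le> ?E (\<lambda>p. 2 * indicator {p. fst p \<noteq> snd p} p)"
  proof (rule integral_mono)
    fix p :: "'a \<times> 'a"
    have "(\<Sum>z\<in>S. \<bar>g z p\<bar>)
        \<le> (\<Sum>z\<in>S. if z = fst p then 1 else 0) + (\<Sum>z\<in>S. if z = snd p then 1 else 0)"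
      unfolding sum.distrib[symmetric] by (intro sum_mono) (auto simp: g_def split: split_indicator)
    also have "\<dots> \<le> 2"
      using \<open>finite S\<close> by simp
    finally show "(\<Sum>z\<in>S. \<bar>g z p\<bar>) \<le> 2 * indicator {p. fst p \<noteq> snd p} p"
      by (cases "fst p = snd p") (simp_all add: g_def)
  qed (auto intro!: integrable_g simp: measure_pmf.emeasure_eq_measure)
  finally show ?thesis
    by simp
qed

locale markov_coupling = finite_markov_chain S K
  for S :: "'a set" and K :: "'a \<Rightarrow> 'a pmf" +
  fixes Q :: "'a \<times> 'a \<Rightarrow> ('a \<times> 'a) pmf"
  assumes map_fst_coupling: "z \<in> S \<times> S \<Longrightarrow> map_pmf fst (Q z) = K (fst z)"
    and map_snd_coupling: "z \<in> S \<times> S \<Longrightarrow> map_pmf snd (Q z) = K (snd z)"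
begin

sublocale pair: finite_markov_chain "S \<times> S" Q
proof
  fix z assume z: "z \<in> S \<times> S"
  then have "fst ` set_pmf (Q z) \<subseteq> S" "snd ` set_pmf (Q z) \<subseteq> S"
    using set_kernel map_fst_coupling[OF z] map_snd_coupling[OF z]
    by (metis mem_Times_iff set_map_pmf)+
  then show "set_pmf (Q z) \<subseteq> S \<times> S"
    by (auto simp: mem_Times_iff)
qed (use finite_states in blast)

lemma tv_distance_le_coupling:
  assumes "S \<noteq> {}" "stationary \<pi>" "\<And>x. x \<in> S \<Longrightarrow> 0 \<le> \<pi> x" "(\<Sum>x\<in>S. \<pi> x) = 1"
    and uncoupled: "\<And>z. z \<in> S \<times> S \<Longrightarrow>
      measure_pmf.prob (kernel_power Q t z) {p. fst p \<noteq> snd p} \<le> B"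
  shows "tv_distance S K \<pi> t \<le> B"
proof (rule tv_distance_le_pairwise[OF assms(1-4)])
  fix x y assume "x \<in> S" "y \<in> S"
  then have xy: "(x, y) \<in> S \<times> S"
    by simp
  then have "map_pmf fst (kernel_power Q t (x, y)) = kernel_power K t x"
    "map_pmf snd (kernel_power Q t (x, y)) = kernel_power K t y"
    using pair.map_kernel_power[OF xy map_fst_coupling]
      pair.map_kernel_power[OF xy map_snd_coupling] by simp_all
  then show "(\<Sum>z\<in>S. \<bar>pmf (kernel_power K t x) z - pmf (kernel_power K t y) z\<bar>) \<le> 2 * B"
    using coupling_inequality[OF finite_states, of "kernel_power Q t (x, y)"] uncoupled[OF xy]
    by simp
qed

end

lemma mixing_time_le:
  assumes "\<And>t. T \<le> t \<Longrightarrow> tv_distance S K \<pi> t \<le> \<epsilon>"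
  shows "mixing_time S K \<pi> \<epsilon> \<le> enat T"
  unfolding mixing_time_def using assms by (intro Inf_lower) blast

lemma mixing_time_le_real:
  assumes "0 \<le> B" "\<And>t. B \<le> real t \<Longrightarrow> tv_distance S K \<pi> t \<le> \<epsilon>"
  shows "ereal_of_enat (mixing_time S K \<pi> \<epsilon>) \<le> ereal (B + 1)"
proof -
  have "mixing_time S K \<pi> \<epsilon> \<le> enat (nat \<lceil>B\<rceil>)"
    by (intro mixing_time_le assms(2)) linarith
  then have "ereal_of_enat (mixing_time S K \<pi> \<epsilon>) \<le> ereal_of_enat (enat (nat \<lceil>B\<rceil>))"
    by (simp only: ereal_of_enat_le_iff)
  also have "\<dots> \<le> ereal (B + 1)"
    using \<open>0 \<le> B\<close> by simp
  finally show ?thesis .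
qed

section \<open>Inversion tables\<close>

text \<open>\<open>p a\<close> is the position of the element \<open>a\<close>; for a permutation \<open>\<sigma>\<close> it is \<open>inv \<sigma> a\<close>.\<close>

definition inv_table :: "nat \<Rightarrow> (nat \<Rightarrow> 'b::linorder) \<Rightarrow> nat \<Rightarrow> nat" where
  "inv_table n p k = card {a \<in> {k<..n}. p a < p k}"

lemma inv_table_le: "inv_table n p k \<le> n - k"
proof -
  have "inv_table n p k \<le> card {k<..n}"
    unfolding inv_table_def by (intro card_mono) auto
  then show ?thesis
    by simp
qed

lemma inv_table_eq_0_iff: "inv_table n p k = 0 \<longleftrightarrow> (\<forall>a\<in>{k<..n}. \<not> p a < p k)"
  by (auto simp: inv_table_def)

lemma inv_table_eq_max_iff: "inv_table n p k = n - k \<longleftrightarrow> (\<forall>a\<in>{k<..n}. p a < p k)"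
proof
  assume "inv_table n p k = n - k"
  then have "{a \<in> {k<..n}. p a < p k} = {k<..n}"
    unfolding inv_table_def by (intro card_subset_eq) auto
  then show "\<forall>a\<in>{k<..n}. p a < p k"
    by blast
next
  assume "\<forall>a\<in>{k<..n}. p a < p k"
  then have "{a \<in> {k<..n}. p a < p k} = {k<..n}"
    by blast
  then show "inv_table n p k = n - k"
    by (simp add: inv_table_def)
qed

text \<open>Either of \<open>i\<close> and \<open>j\<close> may come first, so that the notion serves moves in both directions.\<close>

definition larger_neighbours :: "nat \<Rightarrow> (nat \<Rightarrow> 'b::linorder) \<Rightarrow> nat \<Rightarrow> nat \<Rightarrow> bool" where
  "larger_neighbours n p i j \<longleftrightarrow>
     i < j \<and> j \<le> n \<and> (\<forall>a\<in>{i<..n} - {j}. p a < p i \<longleftrightarrow> p a < p j)"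

lemma larger_neighboursI:
  assumes "inj p" "i < j" "j \<le> n"
    and "\<And>a. a \<in> {i<..n} \<Longrightarrow> \<not> (p i < p a \<and> p a < p j)"
    and "\<And>a. a \<in> {i<..n} \<Longrightarrow> \<not> (p j < p a \<and> p a < p i)"
  shows "larger_neighbours n p i j"
  unfolding larger_neighbours_def
proof (intro conjI ballI)
  fix a assume a: "a \<in> {i<..n} - {j}"
  then have "p a \<noteq> p i" "p a \<noteq> p j"
    using \<open>inj p\<close> by (auto dest: injD)
  then show "p a < p i \<longleftrightarrow> p a < p j"
    using assms(4,5)[of a] a by force
qed fact+

lemma larger_neighbours_comp_transpose:
  assumes "larger_neighbours n p i j"
  shows "larger_neighbours n (p \<circ> Transposition.transpose i j) i j"
  using assms by (auto simp: larger_neighbours_def Transposition.transpose_def)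

lemma inv_table_comp_transpose:
  assumes "inj p" and neighbours: "larger_neighbours n p i j" and "p i < p j"
  shows "inv_table n (p \<circ> Transposition.transpose i j) =
    (inv_table n p)(i := Suc (inv_table n p i))"
proof
  fix k
  let ?t = "Transposition.transpose i j"
  have ij: "i < j" "j \<le> n" and gap: "\<And>a. \<lbrakk>i < a; a \<le> n; a \<noteq> j\<rbrakk> \<Longrightarrow> p a < p i \<longleftrightarrow> p a < p j"
    using neighbours by (auto simp: larger_neighbours_def)
  consider (less) "k < i" | (equal) "k = i" | (greater) "i < k"
    by linarith
  then show "inv_table n (p \<circ> ?t) k = ((inv_table n p)(i := Suc (inv_table n p i))) k"
  proof cases
    case less
    then have "{a \<in> {k<..n}. (p \<circ> ?t) a < (p \<circ> ?t) k} = ?t -` {a \<in> {k<..n}. p a < p k}"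
      using ij by (auto simp: Transposition.transpose_def)
    moreover have "card (?t -` {a \<in> {k<..n}. p a < p k}) = card {a \<in> {k<..n}. p a < p k}"
      by (intro card_vimage_inj) auto
    ultimately show ?thesis
      using less by (simp add: inv_table_def)
  next
    case equal
    have "{a \<in> {i<..n}. (p \<circ> ?t) a < (p \<circ> ?t) i} = insert j {a \<in> {i<..n}. p a < p i}"
      using ij gap \<open>p i < p j\<close> by (auto simp: Transposition.transpose_def)
    moreover have "j \<notin> {a \<in> {i<..n}. p a < p i}"
      using \<open>p i < p j\<close> by auto
    ultimately show ?thesis
      using equal by (simp add: inv_table_def del: greaterThanAtMost_iff mem_Collect_eq)
  next
    case greater
    have "(p \<circ> ?t) a < (p \<circ> ?t) k \<longleftrightarrow> p a < p k" if "k < a" "a \<le> n" for a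
    proof (cases "a = j")
      case True
      moreover have "p k \<noteq> p i" "p k \<noteq> p j"
        using \<open>inj p\<close> greater that True by (auto dest: injD)
      ultimately show ?thesis
        using gap[of k] greater that by (auto simp: Transposition.transpose_def)
    qed (use gap[of a] greater that in \<open>auto simp: Transposition.transpose_def\<close>)
    then have "{a \<in> {k<..n}. (p \<circ> ?t) a < (p \<circ> ?t) k} = {a \<in> {k<..n}. p a < p k}"
      by auto
    then show ?thesis
      using greater by (simp add: inv_table_def)
  qed
qed

lemma initial_segments_eq:
  fixes p :: "'a \<Rightarrow> 'b::linorder" and q :: "'a \<Rightarrow> 'c::linorder"
  assumes "finite X" and order: "\<And>a b. \<lbrakk>a \<in> X; b \<in> X\<rbrakk> \<Longrightarrow> p a < p b \<longleftrightarrow> q a < q b"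
    and card: "card {a \<in> X. p a < s} = card {a \<in> X. q a < t}"
  shows "{a \<in> X. p a < s} = {a \<in> X. q a < t}" (is "?A = ?B")
proof -
  have "?A \<subseteq> ?B \<or> ?B \<subseteq> ?A"
  proof (rule ccontr)
    assume "\<not> ?thesis"
    then obtain a b where ab: "a \<in> X" "b \<in> X" "p a < s" "\<not> q a < t" "q b < t" "\<not> p b < s"
      by blast
    then have "p a < p b" "\<not> q a < q b"
      by auto
    then show False
      using order ab by blast
  qed
  then show ?thesis
    using card_subset_eq[of ?B ?A] card_subset_eq[of ?A ?B] card \<open>finite X\<close> by auto
qed

lemma inv_table_determines_order:
  assumes "inj p" "inj q" and eq: "inv_table n p = inv_table n q" and "a \<le> n" "b \<le> n"
  shows "p a < p b \<longleftrightarrow> q a < q b"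
proof -
  have "\<forall>a\<in>{l..n}. \<forall>b\<in>{l..n}. p a < p b \<longleftrightarrow> q a < q b" if "l \<le> Suc n" for l
    using that
  proof (induction rule: inc_induct)
    case (step l)
    have range: "{l..n} = insert l {l<..n}" "{Suc l..n} = {l<..n}"
      using step.hyps by auto
    note IH = step.IH[unfolded range]
    have "card {a \<in> {l<..n}. p a < p l} = card {a \<in> {l<..n}. q a < q l}"
      using fun_cong[OF eq, of l] by (simp add: inv_table_def)
    then have "{a \<in> {l<..n}. p a < p l} = {a \<in> {l<..n}. q a < q l}"
      by (rule initial_segments_eq[rotated 2]) (use IH in auto)
    then have below: "p a < p l \<longleftrightarrow> q a < q l" if "a \<in> {l<..n}" for a
      using that by blast
    moreover have "p l < p a \<longleftrightarrow> q l < q a" if a: "a \<in> {l<..n}" for a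
    proof -
      have "p a \<noteq> p l" "q a \<noteq> q l"
        using \<open>inj p\<close> \<open>inj q\<close> a by (auto dest: injD)
      then show ?thesis
        using below[OF a] by (metis not_less_iff_gr_or_eq)
    qed
    ultimately show ?case
      using IH unfolding range by auto
  qed simp
  from this[of 0] show ?thesis
    using \<open>a \<le> n\<close> \<open>b \<le> n\<close> by simp
qed

lemma permutes_eq_Suc_card_less:
  fixes p :: "nat \<Rightarrow> nat"
  assumes p: "p permutes {1..n}" and a: "a \<in> {1..n}"
  shows "p a = Suc (card {b \<in> {1..n}. p b < p a})"
proof -
  have "p a \<in> {1..n}"
    using permutes_in_image[OF p] a by blast
  have "p ` {b \<in> {1..n}. p b < p a} = {x \<in> p ` {1..n}. x < p a}"
    by blast
  also have "\<dots> = {1..<p a}"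
    unfolding permutes_image[OF p] using \<open>p a \<in> {1..n}\<close> by auto
  finally have "card {b \<in> {1..n}. p b < p a} = card {1..<p a}"
    using card_image[OF permutes_inj_on[OF p, of "{b \<in> {1..n}. p b < p a}"]] by simp
  then show ?thesis
    using \<open>p a \<in> {1..n}\<close> by simp
qed

lemma permutes_inv_table_inject:
  fixes p q :: "nat \<Rightarrow> nat"
  assumes p: "p permutes {1..n}" and q: "q permutes {1..n}"
    and eq: "\<And>k. k \<in> {1..<n} \<Longrightarrow> inv_table n p k = inv_table n q k"
  shows "p = q"
proof
  fix a
  have "inv_table n p k = inv_table n q k" for k
  proof (cases "k \<in> {1..<n}")
    case False
    then consider "k = 0" | "n \<le> k"
      by fastforce
    then show ?thesis
      using permutes_not_in[OF p, of 0] permutes_not_in[OF q, of 0]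
        inv_table_le[of n p k] inv_table_le[of n q k]
      by cases (auto simp: inv_table_def)
  qed (use eq in blast)
  then have table: "inv_table n p = inv_table n q"
    by blast
  show "p a = q a"
  proof (cases "a \<in> {1..n}")
    case True
    then have "{b \<in> {1..n}. p b < p a} = {b \<in> {1..n}. q b < q a}"
      using inv_table_determines_order[OF permutes_inj[OF p] permutes_inj[OF q] table] by auto
    then show ?thesis
      using permutes_eq_Suc_card_less[OF p True] permutes_eq_Suc_card_less[OF q True] by simp
  qed (use p q in \<open>metis permutes_not_in\<close>)
qed

section \<open>Moves that raise or lower one entry of the inversion table\<close>

lemma finite_Sym: "finite (Sym n)"
  by (simp add: Sym_def finite_permutations)

lemma Sym_nonempty: "Sym n \<noteq> {}"
  using permutes_id[of "{1..n}"] unfolding Sym_def by blast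

lemma transpose_comp_in_Sym:
  "\<lbrakk>\<sigma> \<in> Sym n; i \<in> {1..n}; j \<in> {1..n}\<rbrakk> \<Longrightarrow> Transposition.transpose i j \<circ> \<sigma> \<in> Sym n"
  by (simp add: Sym_def permutes_compose permutes_swap_id)

lemma inv_transpose_comp:
  "\<sigma> \<in> Sym n \<Longrightarrow> inv (Transposition.transpose i j \<circ> \<sigma>) = inv \<sigma> \<circ> Transposition.transpose i j"
  by (simp add: Sym_def permutes_bij o_inv_distrib)

lemma inj_inv_Sym: "\<sigma> \<in> Sym n \<Longrightarrow> inj (inv \<sigma>)"
  unfolding Sym_def by (blast intro: permutes_inj permutes_inv)

lemma Sym_eqI:
  assumes "\<sigma> \<in> Sym n" "\<tau> \<in> Sym n"
    and "\<And>k. k \<in> {1..<n} \<Longrightarrow> inv_table n (inv \<sigma>) k = inv_table n (inv \<tau>) k"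
  shows "\<sigma> = \<tau>"
proof -
  have "inv \<sigma> = inv \<tau>"
    using assms
    by (intro permutes_inv_table_inject[of _ n]) (auto simp: Sym_def intro: permutes_inv)
  then show ?thesis
    using assms(1,2) unfolding Sym_def by (metis mem_Collect_eq permutes_inv_inv)
qed

lemma Sym_eq_iff_inv_table:
  "\<lbrakk>\<sigma> \<in> Sym n; \<tau> \<in> Sym n\<rbrakk> \<Longrightarrow> \<sigma> = \<tau> \<longleftrightarrow> inv_table n (inv \<sigma>) = inv_table n (inv \<tau>)"
  using Sym_eqI by metis

lemma positions_of_larger:
  assumes "\<sigma> \<in> Sym n"
  shows "{k \<in> {1..n}. P k \<and> i < \<sigma> k} = inv \<sigma> ` {a \<in> {i<..n}. P (inv \<sigma> a)}"
proof -
  have \<sigma>: "\<sigma> permutes {1..n}"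
    using assms by (simp add: Sym_def)
  have "{k \<in> {1..n}. P k \<and> i < \<sigma> k} = {k \<in> inv \<sigma> ` {1..n}. P k \<and> i < \<sigma> k}"
    unfolding permutes_image[OF permutes_inv[OF \<sigma>]] ..
  also have "\<dots> = inv \<sigma> ` {a \<in> {1..n}. P (inv \<sigma> a) \<and> i < a}"
    using permutes_inverses(1)[OF \<sigma>] by auto
  also have "{a \<in> {1..n}. P (inv \<sigma> a) \<and> i < a} = {a \<in> {i<..n}. P (inv \<sigma> a)}"
    by auto
  finally show ?thesis .
qed

lemma next_larger_eq_None_iff:
  assumes "\<sigma> \<in> Sym n"
  shows "next_larger n \<sigma> i = None \<longleftrightarrow> inv_table n (inv \<sigma>) i = n - i"
proof -
  have "inv \<sigma> i < inv \<sigma> a \<longleftrightarrow> \<not> inv \<sigma> a < inv \<sigma> i" if "a \<in> {i<..n}" for a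
    using injD[OF inj_inv_Sym[OF assms], of a i] that by (auto simp: not_less le_less)
  then show ?thesis
    unfolding next_larger_def Let_def positions_of_larger[OF assms] inv_table_eq_max_iff by auto
qed

lemma prev_larger_eq_None_iff:
  assumes "\<sigma> \<in> Sym n"
  shows "prev_larger n \<sigma> i = None \<longleftrightarrow> inv_table n (inv \<sigma>) i = 0"
  unfolding prev_larger_def Let_def positions_of_larger[OF assms] inv_table_eq_0_iff by auto

lemma element_at_position:
  assumes "\<sigma> \<in> Sym n" "k \<in> inv \<sigma> ` A"
  shows "\<sigma> k \<in> A" "inv \<sigma> (\<sigma> k) = k"
  using assms by (auto simp: Sym_def permutes_inverses)

lemma next_larger_eq_SomeD:
  assumes \<sigma>: "\<sigma> \<in> Sym n" and "next_larger n \<sigma> i = Some j"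
  shows "larger_neighbours n (inv \<sigma>) i j" "inv \<sigma> i < inv \<sigma> j"
proof -
  let ?A = "{a \<in> {i<..n}. inv \<sigma> i < inv \<sigma> a}"
  have j: "?A \<noteq> {}" "j = \<sigma> (Min (inv \<sigma> ` ?A))"
    using assms(2) unfolding next_larger_def Let_def positions_of_larger[OF \<sigma>]
    by (auto split: if_splits)
  then have "Min (inv \<sigma> ` ?A) \<in> inv \<sigma> ` ?A"
    by (intro Min_in) auto
  note pos = element_at_position[OF \<sigma> this, folded j(2)]
  show less: "inv \<sigma> i < inv \<sigma> j"
    using pos(1) by simp
  have "\<forall>a\<in>?A. inv \<sigma> j \<le> inv \<sigma> a"
    unfolding pos(2) by simp
  then show "larger_neighbours n (inv \<sigma>) i j"
    using pos(1) less by (intro larger_neighboursI inj_inv_Sym[OF \<sigma>]) (auto simp: not_less)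
qed

lemma prev_larger_eq_SomeD:
  assumes \<sigma>: "\<sigma> \<in> Sym n" and "prev_larger n \<sigma> i = Some j"
  shows "larger_neighbours n (inv \<sigma>) i j" "inv \<sigma> j < inv \<sigma> i"
proof -
  let ?A = "{a \<in> {i<..n}. inv \<sigma> a < inv \<sigma> i}"
  have j: "?A \<noteq> {}" "j = \<sigma> (Max (inv \<sigma> ` ?A))"
    using assms(2) unfolding prev_larger_def Let_def positions_of_larger[OF \<sigma>]
    by (auto split: if_splits)
  then have "Max (inv \<sigma> ` ?A) \<in> inv \<sigma> ` ?A"
    by (intro Max_in) auto
  note pos = element_at_position[OF \<sigma> this, folded j(2)]
  show less: "inv \<sigma> j < inv \<sigma> i"
    using pos(1) by simp
  have "\<forall>a\<in>?A. inv \<sigma> a \<le> inv \<sigma> j"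
    unfolding pos(2) by simp
  then show "larger_neighbours n (inv \<sigma>) i j"
    using pos(1) less by (intro larger_neighboursI inj_inv_Sym[OF \<sigma>]) (auto simp: not_less)
qed

definition raise :: "nat \<Rightarrow> nat \<Rightarrow> (nat \<Rightarrow> nat) \<Rightarrow> nat \<Rightarrow> nat" where
  "raise n i \<sigma> = (case next_larger n \<sigma> i of None \<Rightarrow> \<sigma> | Some j \<Rightarrow> Transposition.transpose i j \<circ> \<sigma>)"

definition lower :: "nat \<Rightarrow> nat \<Rightarrow> (nat \<Rightarrow> nat) \<Rightarrow> nat \<Rightarrow> nat" where
  "lower n i \<sigma> = (case prev_larger n \<sigma> i of None \<Rightarrow> \<sigma> | Some j \<Rightarrow> Transposition.transpose i j \<circ> \<sigma>)"

lemma raise_in_Sym: "\<lbrakk>\<sigma> \<in> Sym n; 1 \<le> i\<rbrakk> \<Longrightarrow> raise n i \<sigma> \<in> Sym n"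
  by (auto simp: raise_def larger_neighbours_def split: option.split intro!: transpose_comp_in_Sym
      dest: next_larger_eq_SomeD)

lemma lower_in_Sym: "\<lbrakk>\<sigma> \<in> Sym n; 1 \<le> i\<rbrakk> \<Longrightarrow> lower n i \<sigma> \<in> Sym n"
  by (auto simp: lower_def larger_neighbours_def split: option.split intro!: transpose_comp_in_Sym
      dest: prev_larger_eq_SomeD)

lemma inv_table_raise:
  assumes \<sigma>: "\<sigma> \<in> Sym n"
  shows "inv_table n (inv (raise n i \<sigma>)) =
    (inv_table n (inv \<sigma>))(i := min (n - i) (Suc (inv_table n (inv \<sigma>) i)))"
proof (cases "next_larger n \<sigma> i")
  case None
  then show ?thesis
    using next_larger_eq_None_iff[OF \<sigma>, of i] by (simp add: raise_def fun_upd_idem)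
next
  case (Some j)
  then have "inv_table n (inv (raise n i \<sigma>)) =
      (inv_table n (inv \<sigma>))(i := Suc (inv_table n (inv \<sigma>) i))"
    using inv_table_comp_transpose[OF inj_inv_Sym[OF \<sigma>] next_larger_eq_SomeD[OF \<sigma> Some]]
    by (simp add: raise_def inv_transpose_comp[OF \<sigma>])
  then show ?thesis
    using inv_table_le[of n "inv (raise n i \<sigma>)" i] by (simp add: min_def)
qed

lemma inv_table_lower:
  assumes \<sigma>: "\<sigma> \<in> Sym n"
  shows "inv_table n (inv (lower n i \<sigma>)) = (inv_table n (inv \<sigma>))(i := inv_table n (inv \<sigma>) i - 1)"
proof (cases "prev_larger n \<sigma> i")
  case None
  then show ?thesis
    using prev_larger_eq_None_iff[OF \<sigma>, of i] by (simp add: lower_def fun_upd_idem)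
next
  case (Some j)
  let ?t = "Transposition.transpose i j"
  let ?p = "inv \<sigma> \<circ> ?t"
  note neighbours = prev_larger_eq_SomeD[OF \<sigma> Some]
  have "inj ?p"
    by (intro inj_compose inj_inv_Sym[OF \<sigma>]) simp
  then have "inv_table n (?p \<circ> ?t) = (inv_table n ?p)(i := Suc (inv_table n ?p i))"
    using neighbours(2)
    by (intro inv_table_comp_transpose larger_neighbours_comp_transpose neighbours(1)) simp_all
  moreover have "?p \<circ> ?t = inv \<sigma>"
    by (simp add: fun_eq_iff)
  ultimately show ?thesis
    using Some by (simp add: lower_def inv_transpose_comp[OF \<sigma>])
qed

lemma raise_eq_iff_lower_eq:
  assumes Sym: "\<sigma> \<in> Sym n" "\<tau> \<in> Sym n" and "1 \<le> i" "\<sigma> \<noteq> \<tau>"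
  shows "raise n i \<sigma> = \<tau> \<longleftrightarrow> lower n i \<tau> = \<sigma>"
proof -
  define x y where "x = inv_table n (inv \<sigma>)" and "y = inv_table n (inv \<tau>)"
  have "x \<noteq> y"
    using Sym_eq_iff_inv_table[OF Sym] \<open>\<sigma> \<noteq> \<tau>\<close> by (simp add: x_def y_def)
  have "raise n i \<sigma> = \<tau> \<longleftrightarrow> x(i := min (n - i) (Suc (x i))) = y"
    unfolding Sym_eq_iff_inv_table[OF raise_in_Sym[OF Sym(1) \<open>1 \<le> i\<close>] Sym(2)]
    by (simp add: inv_table_raise[OF Sym(1)] x_def y_def)
  also have "\<dots> \<longleftrightarrow> y(i := y i - 1) = x"
  proof
    assume y: "x(i := min (n - i) (Suc (x i))) = y"
    then have "min (n - i) (Suc (x i)) \<noteq> x i"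
      using \<open>x \<noteq> y\<close> by (metis fun_upd_triv)
    then have "y i = Suc (x i)"
      using y inv_table_le[of n "inv \<sigma>" i] by (auto simp: x_def)
    then show "y(i := y i - 1) = x"
      using y by auto
  next
    assume x: "y(i := y i - 1) = x"
    then have "y i - 1 \<noteq> y i"
      using \<open>x \<noteq> y\<close> by (metis fun_upd_triv)
    then have "min (n - i) (Suc (x i)) = y i"
      using x inv_table_le[of n "inv \<tau>" i] by (auto simp: y_def)
    then show "x(i := min (n - i) (Suc (x i))) = y"
      using x by auto
  qed
  also have "\<dots> \<longleftrightarrow> lower n i \<tau> = \<sigma>"
    unfolding Sym_eq_iff_inv_table[OF lower_in_Sym[OF Sym(2) \<open>1 \<le> i\<close>] Sym(1)]
    by (simp add: inv_table_lower[OF Sym(2)] x_def y_def)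
  finally show ?thesis .
qed

section \<open>Weights of permutations\<close>

lemma ordered_pairs_eq:
  fixes p :: "nat \<Rightarrow> 'b::linorder"
  assumes "inj p"
  shows "{(a, b). a \<in> {1..n} \<and> b \<in> {1..n} \<and> p a < p b} =
    (SIGMA i:{1..n}. {i<..n} - {a \<in> {i<..n}. p a < p i}) \<union>
    prod.swap ` (SIGMA i:{1..n}. {a \<in> {i<..n}. p a < p i})" (is "?L = ?R")
proof -
  have "(a, b) \<in> ?L \<longleftrightarrow> (a, b) \<in> ?R" for a b
  proof (cases a b rule: linorder_cases)
    case less
    then have "p a < p b \<longleftrightarrow> \<not> p b < p a"
      using injD[OF \<open>inj p\<close>, of a b] by (auto simp: not_less le_less)
    with less show ?thesis
      by auto
  qed auto
  then show ?thesis
    by (intro subset_antisym subrelI) (simp only:)+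
qed

lemma weight_choose_prob:
  assumes \<sigma>: "\<sigma> \<in> Sym n"
  shows "weight n (choose_prob r) \<sigma> =
    (\<Prod>i\<in>{1..n}. r i ^ (n - i - inv_table n (inv \<sigma>) i) * (1 - r i) ^ inv_table n (inv \<sigma>) i)"
proof -
  let ?before = "\<lambda>i. {a \<in> {i<..n}. inv \<sigma> a < inv \<sigma> i}"
  let ?A = "SIGMA i:{1..n}. {i<..n} - ?before i" and ?B = "SIGMA i:{1..n}. ?before i"
  have card_after: "card ({i<..n} - ?before i) = n - i - inv_table n (inv \<sigma>) i" for i
    unfolding inv_table_def by (subst card_Diff_subset) auto
  have "weight n (choose_prob r) \<sigma> =
      (\<Prod>(a, b)\<in>?A. choose_prob r a b) * (\<Prod>(a, b)\<in>prod.swap ` ?B. choose_prob r a b)"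
    unfolding weight_def ordered_pairs_eq[OF inj_inv_Sym[OF \<sigma>]]
    by (intro prod.union_disjoint finite_imageI finite_SigmaI) auto
  also have "(\<Prod>(a, b)\<in>?A. choose_prob r a b) = (\<Prod>(i, a)\<in>?A. r i)"
    by (intro prod.cong) (auto simp: choose_prob_def)
  also have "(\<Prod>(a, b)\<in>prod.swap ` ?B. choose_prob r a b) = (\<Prod>(i, a)\<in>?B. 1 - r i)"
    by (subst prod.reindex) (auto simp: choose_prob_def intro!: prod.cong)
  also have "(\<Prod>(i, a)\<in>?A. r i) = (\<Prod>i\<in>{1..n}. r i ^ card ({i<..n} - ?before i))"
    by (subst prod.Sigma[symmetric]) auto
  also have "(\<Prod>(i, a)\<in>?B. 1 - r i) = (\<Prod>i\<in>{1..n}. (1 - r i) ^ card (?before i))"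
    by (subst prod.Sigma[symmetric]) auto
  finally show ?thesis
    unfolding card_after inv_table_def[symmetric] prod.distrib[symmetric] .
qed

lemma weight_pos:
  assumes "\<sigma> \<in> Sym n" and r: "\<And>i. i \<in> {1..<n} \<Longrightarrow> 0 < r i \<and> r i < 1"
  shows "0 < weight n (choose_prob r) \<sigma>"
  unfolding weight_choose_prob[OF assms(1)]
proof (rule prod_pos)
  fix i assume i: "i \<in> {1..n}"
  show "0 < r i ^ (n - i - inv_table n (inv \<sigma>) i) * (1 - r i) ^ inv_table n (inv \<sigma>) i"
  proof (cases "i = n")
    case True
    then show ?thesis
      using inv_table_le[of n "inv \<sigma>" n] by simp
  next
    case False
    then show ?thesis
      using r[of i] i by simp
  qed
qed

lemma weight_raise:
  assumes \<sigma>: "\<sigma> \<in> Sym n" and i: "i \<in> {1..n}" and "raise n i \<sigma> \<noteq> \<sigma>"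
  shows "r i * weight n (choose_prob r) (raise n i \<sigma>) = (1 - r i) * weight n (choose_prob r) \<sigma>"
proof -
  let ?x = "inv_table n (inv \<sigma>)"
  have "1 \<le> i"
    using i by simp
  define rest where "rest = (\<Prod>k\<in>{1..n}-{i}. r k ^ (n - k - ?x k) * (1 - r k) ^ ?x k)"
  have "?x i \<noteq> n - i"
    using assms(3) next_larger_eq_None_iff[OF \<sigma>, of i] by (auto simp: raise_def)
  then have x: "?x i < n - i"
    using inv_table_le[of n "inv \<sigma>" i] by simp
  then have raised: "inv_table n (inv (raise n i \<sigma>)) = ?x(i := Suc (?x i))"
    by (simp add: inv_table_raise[OF \<sigma>])
  have "weight n (choose_prob r) \<sigma> = r i ^ (n - i - ?x i) * (1 - r i) ^ ?x i * rest"
    unfolding weight_choose_prob[OF \<sigma>] rest_def using i by (intro prod.remove) auto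
  moreover have "weight n (choose_prob r) (raise n i \<sigma>) =
      r i ^ (n - i - Suc (?x i)) * (1 - r i) ^ Suc (?x i) * rest"
    unfolding weight_choose_prob[OF raise_in_Sym[OF \<sigma> \<open>1 \<le> i\<close>]] raised rest_def
    using i by (subst prod.remove[of _ i]) (auto intro!: prod.cong)
  moreover have "n - i - ?x i = Suc (n - i - Suc (?x i))"
    using x by simp
  ultimately show ?thesis
    by simp
qed

section \<open>The chain and its coupling\<close>

text \<open>The acceptance coin is drawn even if no swap is possible, so that the same randomness can
  drive two copies of the chain.\<close>

definition step_pmf :: "nat \<Rightarrow> (nat \<Rightarrow> real) \<Rightarrow> (nat \<Rightarrow> 'a) \<Rightarrow> (nat \<Rightarrow> 'a) \<Rightarrow> 'a \<Rightarrow> 'a pmf" where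
  "step_pmf n r up down x =
     do {
       i \<leftarrow> select_pmf n;
       b \<leftarrow> pmf_of_set {-1, 1 :: int};
       accept \<leftarrow> bernoulli_pmf ((if b = 1 then 1 - r i else r i) / 2);
       return_pmf (if accept then if b = 1 then up i else down i else x)
     }"

lemma M_inv_eq_step_pmf:
  assumes "\<sigma> \<in> Sym n"
  shows "M_inv n (choose_prob r) \<sigma> = step_pmf n r (\<lambda>i. raise n i \<sigma>) (\<lambda>i. lower n i \<sigma>) \<sigma>"
  unfolding M_inv_def step_pmf_def
proof (intro bind_pmf_cong refl)
  fix i and b :: int
  show "(case if b = 1 then next_larger n \<sigma> i else prev_larger n \<sigma> i of None \<Rightarrow> return_pmf \<sigma>
      | Some j \<Rightarrow> bernoulli_pmf ((if b = 1 then choose_prob r j i else choose_prob r i j) / 2) \<bind>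
          (\<lambda>accept. return_pmf (if accept then Transposition.transpose i j \<circ> \<sigma> else \<sigma>)))
    = bernoulli_pmf ((if b = 1 then 1 - r i else r i) / 2) \<bind>
      (\<lambda>accept. return_pmf (if accept then if b = 1 then raise n i \<sigma> else lower n i \<sigma> else \<sigma>))"
    using next_larger_eq_SomeD(1)[OF assms, of i] prev_larger_eq_SomeD(1)[OF assms, of i]
    unfolding raise_def lower_def
    by (auto simp: choose_prob_def larger_neighbours_def split: option.split cong: if_cong)
qed

lemma map_step_pmf:
  "map_pmf f (step_pmf n r up down x) = step_pmf n r (\<lambda>i. f (up i)) (\<lambda>i. f (down i)) (f x)"
  unfolding step_pmf_def map_bind_pmf map_return_pmf by (intro bind_pmf_cong refl) auto

lemma set_select_pmf: "2 \<le> n \<Longrightarrow> set_pmf (select_pmf n) \<subseteq> {1..<n}"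
  by (auto simp: set_pmf_eq pmf_select_pmf split: if_splits)

lemma set_step_pmf:
  assumes "2 \<le> n" "x \<in> S" "\<And>i. i \<in> {1..<n} \<Longrightarrow> up i \<in> S \<and> down i \<in> S"
  shows "set_pmf (step_pmf n r up down x) \<subseteq> S"
  using set_select_pmf[OF assms(1)] assms(2,3) unfolding step_pmf_def set_bind_pmf by force

lemma expectation_step_pmf:
  fixes h :: "'a \<Rightarrow> real"
  assumes n: "2 \<le> n" and r: "\<And>i. i \<in> {1..<n} \<Longrightarrow> 0 \<le> r i \<and> r i \<le> 1"
  shows "measure_pmf.expectation (step_pmf n r up down x) h =
    (\<Sum>i\<in>{1..<n}. pmf (select_pmf n) i *
      (((1 - r i) * h (up i) + r i * h (down i)) / 4 + 3 / 4 * h x))"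
proof -
  define flip where "flip i b = bernoulli_pmf ((if b = (1::int) then 1 - r i else r i) / 2) \<bind>
      (\<lambda>accept. return_pmf (if accept then if b = 1 then up i else down i else x))" for i b
  have finite_flip: "finite (set_pmf (flip i b))" for i b
    by (simp add: flip_def)
  have coin: "measure_pmf.expectation (flip i b) h =
      (if b = 1 then (1 - r i) / 2 * h (up i) + (1 + r i) / 2 * h x
       else r i / 2 * h (down i) + (2 - r i) / 2 * h x)" if "i \<in> {1..<n}" for i b
    using r[OF that] unfolding flip_def
    by (subst pmf_expectation_bind[of UNIV]) (auto simp: UNIV_bool field_simps)
  have direction: "measure_pmf.expectation (pmf_of_set {-1, 1 :: int} \<bind> flip i) h =
      ((1 - r i) * h (up i) + r i * h (down i)) / 4 + 3 / 4 * h x" if "i \<in> {1..<n}" for i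
    using finite_flip
    by (subst pmf_expectation_bind[of "{-1, 1}"]) (auto simp: coin[OF that] field_simps)
  have "step_pmf n r up down x = select_pmf n \<bind> (\<lambda>i. pmf_of_set {-1, 1} \<bind> flip i)"
    by (simp add: step_pmf_def flip_def[abs_def])
  also have "measure_pmf.expectation \<dots> h = (\<Sum>i\<in>{1..<n}. pmf (select_pmf n) i *\<^sub>R
      measure_pmf.expectation (pmf_of_set {-1, 1 :: int} \<bind> flip i) h)"
    by (rule pmf_expectation_bind) (use set_select_pmf[OF n] finite_flip in auto)
  also have "\<dots> = (\<Sum>i\<in>{1..<n}. pmf (select_pmf n) i *
      (((1 - r i) * h (up i) + r i * h (down i)) / 4 + 3 / 4 * h x))"
    by (intro sum.cong refl) (simp add: direction)
  finally show ?thesis .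
qed

definition coupled_step :: "nat \<Rightarrow> (nat \<Rightarrow> real) \<Rightarrow> (nat \<Rightarrow> nat) \<times> (nat \<Rightarrow> nat) \<Rightarrow>
    ((nat \<Rightarrow> nat) \<times> (nat \<Rightarrow> nat)) pmf" where
  "coupled_step n r z = step_pmf n r (\<lambda>i. map_prod (raise n i) (raise n i) z)
     (\<lambda>i. map_prod (lower n i) (lower n i) z) z"

locale inversion_chain =
  fixes n :: nat and r :: "nat \<Rightarrow> real"
  assumes n_ge_2: "2 \<le> n" and r_bounds: "i \<in> {1..<n} \<Longrightarrow> 0 < r i \<and> r i < 1"
begin

abbreviation M :: "(nat \<Rightarrow> nat) \<Rightarrow> (nat \<Rightarrow> nat) pmf" where
  "M \<equiv> M_inv n (choose_prob r)"

abbreviation tv :: "nat \<Rightarrow> real" where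
  "tv \<equiv> tv_distance (Sym n) M (target n (choose_prob r))"

sublocale markov_coupling "Sym n" M "coupled_step n r"
proof
  show "set_pmf (M \<sigma>) \<subseteq> Sym n" if "\<sigma> \<in> Sym n" for \<sigma>
    unfolding M_inv_eq_step_pmf[OF that]
    by (rule set_step_pmf[OF n_ge_2 that]) (simp add: that raise_in_Sym lower_in_Sym)
qed (auto simp: finite_Sym coupled_step_def map_step_pmf M_inv_eq_step_pmf)

lemma r_nonneg_le_1: "i \<in> {1..<n} \<Longrightarrow> 0 \<le> r i \<and> r i \<le> 1"
  using r_bounds[of i] by simp

lemma pmf_M:
  assumes "\<sigma> \<in> Sym n"
  shows "pmf (M \<sigma>) \<tau> = (\<Sum>i\<in>{1..<n}. pmf (select_pmf n) i *
    (((1 - r i) * of_bool (raise n i \<sigma> = \<tau>) + r i * of_bool (lower n i \<sigma> = \<tau>)) / 4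
      + 3 / 4 * of_bool (\<sigma> = \<tau>)))"
proof -
  have "pmf (M \<sigma>) \<tau> = measure_pmf.expectation (M \<sigma>) (indicator {\<tau>})"
    by (simp add: measure_pmf_single)
  also have "indicator {\<tau>} = (\<lambda>x. of_bool (x = \<tau>) :: real)"
    by (auto simp: fun_eq_iff)
  finally show ?thesis
    unfolding M_inv_eq_step_pmf[OF assms]
    by (simp only: expectation_step_pmf[OF n_ge_2 r_nonneg_le_1])
qed

lemma weight_detailed_balance:
  assumes Sym: "\<sigma> \<in> Sym n" "\<tau> \<in> Sym n"
  shows "weight n (choose_prob r) \<sigma> * pmf (M \<sigma>) \<tau> =
    weight n (choose_prob r) \<tau> * pmf (M \<tau>) \<sigma>"
proof (cases "\<sigma> = \<tau>")
  case False
  let ?W = "weight n (choose_prob r)"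
  define rate where "rate i \<rho> \<rho>' =
      (1 - r i) * of_bool (raise n i \<rho> = \<rho>') + r i * of_bool (lower n i \<rho> = \<rho>')" for i \<rho> \<rho>'
  have pmf: "pmf (M \<rho>) \<rho>' = (\<Sum>i\<in>{1..<n}. pmf (select_pmf n) i / 4 * rate i \<rho> \<rho>')"
    if "\<rho> \<in> Sym n" "\<rho> \<noteq> \<rho>'" for \<rho> \<rho>'
    using that by (simp add: pmf_M rate_def)
  have raise: "?W \<rho> * ((1 - r i) * of_bool (raise n i \<rho> = \<rho>')) =
      ?W \<rho>' * (r i * of_bool (lower n i \<rho>' = \<rho>))"
    if "i \<in> {1..<n}" "\<rho> \<in> Sym n" "\<rho>' \<in> Sym n" "\<rho> \<noteq> \<rho>'" for i \<rho> \<rho>'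
    using that weight_raise[of \<rho> n i r] raise_eq_iff_lower_eq[of \<rho> n \<rho>' i]
    by (auto simp: mult.commute)
  have "?W \<sigma> * rate i \<sigma> \<tau> = ?W \<tau> * rate i \<tau> \<sigma>" if i: "i \<in> {1..<n}" for i
    unfolding rate_def distrib_left using raise[OF i Sym False] raise[OF i Sym(2,1)] False by simp
  then have "(\<Sum>i\<in>{1..<n}. pmf (select_pmf n) i / 4 * (?W \<sigma> * rate i \<sigma> \<tau>)) =
      (\<Sum>i\<in>{1..<n}. pmf (select_pmf n) i / 4 * (?W \<tau> * rate i \<tau> \<sigma>))"
    by (intro sum.cong) simp_all
  then show ?thesis
    using False by (simp add: pmf Sym sum_distrib_left mult.left_commute del: times_divide_eq_left)
qed simp

lemma sum_weight_pos: "0 < (\<Sum>\<sigma>\<in>Sym n. weight n (choose_prob r) \<sigma>)"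
  using finite_Sym Sym_nonempty weight_pos[OF _ r_bounds] by (intro sum_pos)

lemma stationary_target: "stationary (target n (choose_prob r))"
  by (rule stationary_if_reversible) (simp add: target_def weight_detailed_balance)

lemma target_nonneg: "\<sigma> \<in> Sym n \<Longrightarrow> 0 \<le> target n (choose_prob r) \<sigma>"
  using weight_pos[of \<sigma> n r, OF _ r_bounds] sum_weight_pos by (simp add: target_def)

lemma sum_target: "(\<Sum>\<sigma>\<in>Sym n. target n (choose_prob r) \<sigma>) = 1"
  using sum_weight_pos by (simp add: target_def flip: sum_divide_distrib)

lemma tv_le_prob_uncoupled:
  assumes "\<And>z. z \<in> Sym n \<times> Sym n \<Longrightarrow>
    measure_pmf.prob (kernel_power (coupled_step n r) t z) {p. fst p \<noteq> snd p} \<le> B"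
  shows "tv t \<le> B"
  by (intro tv_distance_le_coupling Sym_nonempty stationary_target target_nonneg sum_target assms)

end

section \<open>Contracting weights on a segment\<close>

definition potential :: "(nat \<Rightarrow> real) \<Rightarrow> nat \<Rightarrow> real" where
  "potential w x = (\<Sum>k\<in>{1..x}. w k)"

lemma potential_0: "potential w 0 = 0"
  and potential_Suc: "potential w (Suc x) = potential w x + w (Suc x)"
  by (simp_all add: potential_def)

text \<open>\<open>w k\<close> is the length of the edge between \<open>k - 1\<close> and \<open>k\<close> in the segment \<open>{0..m}\<close>; the edges \<open>0\<close>
  and \<open>m + 1\<close> do not exist, but giving them a nonnegative length avoids a case distinction.\<close>

locale contracting_weights =
  fixes m :: nat and q c :: real and w :: "nat \<Rightarrow> real"
  assumes q_nonneg: "0 \<le> q" and q_le_1: "q \<le> 1"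
    and weight_ge_1: "k < m \<Longrightarrow> 1 \<le> w (Suc k)"
    and weight_0_nonneg: "0 \<le> w 0" and weight_Suc_m_nonneg: "0 \<le> w (Suc m)"
    and contraction: "k < m \<Longrightarrow> q * w k + (1 - q) * w (Suc (Suc k)) \<le> (1 - c) * w (Suc k)"
begin

lemma weight_nonneg: "k \<le> Suc m \<Longrightarrow> 0 \<le> w k"
  using weight_ge_1[of "k - 1"] weight_0_nonneg weight_Suc_m_nonneg
  by (cases k) (auto simp: le_Suc_eq elim: order_trans[rotated])

lemma rate_le_1:
  assumes "0 < m"
  shows "c \<le> 1"
proof -
  have "0 \<le> q * w 0 + (1 - q) * w (Suc (Suc 0))"
    using q_nonneg q_le_1 weight_nonneg assms by simp
  then have "0 \<le> (1 - c) * w 1"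
    using contraction[OF assms] by simp
  then show ?thesis
    using weight_ge_1[OF assms] by (simp add: zero_le_mult_iff)
qed

lemma potential_mono: "\<lbrakk>x \<le> y; y \<le> m\<rbrakk> \<Longrightarrow> potential w x \<le> potential w y"
  unfolding potential_def by (intro sum_mono2) (auto intro: weight_nonneg)

lemma potential_contraction_ordered:
  assumes "x \<le> y" "y \<le> m"
  shows "(1 - q) * (potential w (min m (Suc y)) - potential w (min m (Suc x)))
    + q * (potential w (y - 1) - potential w (x - 1)) \<le> (1 - c) * (potential w y - potential w x)"
  using assms
proof (induction y rule: dec_induct)
  case (step k)
  have "potential w (min m (Suc (Suc k))) \<le> potential w (min m (Suc k)) + w (Suc (Suc k))"
  proof (cases "Suc k < m")
    case False
    then have "m = Suc k"
      using step.prems by simp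
    then show ?thesis
      using weight_Suc_m_nonneg by simp
  qed (simp add: min_absorb2 Suc_leI potential_Suc)
  then have "(1 - q) * potential w (min m (Suc (Suc k)))
      \<le> (1 - q) * (potential w (min m (Suc k)) + w (Suc (Suc k)))"
    using q_le_1 by (intro mult_left_mono) auto
  moreover have "potential w k \<le> potential w (k - 1) + w k"
    using weight_0_nonneg by (cases k) (simp_all add: potential_Suc)
  then have "q * potential w k \<le> q * (potential w (k - 1) + w k)"
    using q_nonneg by (intro mult_left_mono) auto
  ultimately show ?case
    using step.IH step.prems contraction[of k] by (simp add: potential_Suc algebra_simps)
qed simp

lemma potential_contraction:
  assumes "x \<le> m" "y \<le> m"
  shows "(1 - q) * \<bar>potential w (min m (Suc x)) - potential w (min m (Suc y))\<bar>
    + q * \<bar>potential w (x - 1) - potential w (y - 1)\<bar> \<le> (1 - c) * \<bar>potential w x - potential w y\<bar>"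
  using assms
proof (induction x y rule: linorder_wlog)
  case (le x y)
  then have "potential w (min m (Suc x)) \<le> potential w (min m (Suc y))"
    "potential w (x - 1) \<le> potential w (y - 1)" "potential w x \<le> potential w y"
    by (auto intro!: potential_mono)
  then show ?case
    using potential_contraction_ordered[of x y] le by simp
qed (simp add: abs_minus_commute)

lemma potential_diff_ge_1:
  assumes "x \<le> m" "y \<le> m" "x \<noteq> y"
  shows "1 \<le> \<bar>potential w x - potential w y\<bar>"
  using assms
proof (induction x y rule: linorder_wlog)
  case (le x y)
  then have "potential w (Suc x) \<le> potential w y"
    by (intro potential_mono) auto
  then show ?case
    using le weight_ge_1[of x] by (simp add: potential_Suc)
qed (simp add: abs_minus_commute)

lemma potential_diff_le:
  assumes "x \<le> m" "y \<le> m"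
  shows "\<bar>potential w x - potential w y\<bar> \<le> potential w m"
  using potential_mono[of 0 x] potential_mono[of 0 y] potential_mono[of x m]
    potential_mono[of y m] assms by (simp add: potential_0)

end

section \<open>Contraction of the coupled chain\<close>

definition coord_dist :: "nat \<Rightarrow> nat \<Rightarrow> (nat \<Rightarrow> real) \<Rightarrow> (nat \<Rightarrow> nat) \<times> (nat \<Rightarrow> nat) \<Rightarrow> real" where
  "coord_dist n i w z =
     \<bar>potential w (inv_table n (inv (fst z)) i) - potential w (inv_table n (inv (snd z)) i)\<bar>"

lemma coord_dist_nonneg: "0 \<le> coord_dist n i w z"
  by (simp add: coord_dist_def)

context inversion_chain
begin

lemma sum_select_pmf: "(\<Sum>i\<in>{1..<n}. pmf (select_pmf n) i) = 1"
  by (intro sum_pmf_eq_1 set_select_pmf n_ge_2) simp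

lemma expectation_coord_dist_le:
  assumes i: "i \<in> {1..<n}" and z: "z \<in> Sym n \<times> Sym n"
    and "contracting_weights (n - i) (r i) c w"
  shows "measure_pmf.expectation (coupled_step n r z) (coord_dist n i w)
    \<le> (1 - pmf (select_pmf n) i * (c / 4)) * coord_dist n i w z"
proof -
  interpret contracting_weights "n - i" "r i" c w by fact
  let ?s = "pmf (select_pmf n)" and ?d = "coord_dist n i w"
  let ?up = "\<lambda>k. map_prod (raise n k) (raise n k) z"
    and ?down = "\<lambda>k. map_prod (lower n k) (lower n k) z"
  have Sym: "fst z \<in> Sym n" "snd z \<in> Sym n"
    using z by auto
  note tables = inv_table_raise[OF Sym(1)] inv_table_raise[OF Sym(2)]
    inv_table_lower[OF Sym(1)] inv_table_lower[OF Sym(2)]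
  have other: "?d (?up k) = ?d z" "?d (?down k) = ?d z" if "k \<noteq> i" for k
    using that by (simp_all add: coord_dist_def tables)
  have "(1 - r i) * ?d (?up i) + r i * ?d (?down i) \<le> (1 - c) * ?d z"
    using potential_contraction[OF inv_table_le[of n "inv (fst z)" i]
        inv_table_le[of n "inv (snd z)" i]]
    by (simp add: coord_dist_def tables)
  then have bound: "((1 - r k) * ?d (?up k) + r k * ?d (?down k)) / 4 + 3 / 4 * ?d z
      \<le> ?d z - (if k = i then c / 4 * ?d z else 0)" for k
    by (cases "k = i") (simp_all add: other field_simps)
  have "measure_pmf.expectation (coupled_step n r z) ?d
      = (\<Sum>k\<in>{1..<n}. ?s k * (((1 - r k) * ?d (?up k) + r k * ?d (?down k)) / 4 + 3 / 4 * ?d z))"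
    unfolding coupled_step_def by (rule expectation_step_pmf[OF n_ge_2 r_nonneg_le_1])
  also have "\<dots> \<le> (\<Sum>k\<in>{1..<n}. ?s k * (?d z - (if k = i then c / 4 * ?d z else 0)))"
    by (intro sum_mono mult_left_mono bound) simp
  also have "\<dots> = (\<Sum>k\<in>{1..<n}. ?s k * ?d z - (if k = i then ?s i * (c / 4 * ?d z) else 0))"
    by (intro sum.cong) (auto simp: right_diff_distrib)
  also have "\<dots> = (\<Sum>k\<in>{1..<n}. ?s k) * ?d z - ?s i * (c / 4 * ?d z)"
    using i by (simp add: sum_subtractf sum_distrib_right del: atLeastLessThan_iff)
  finally show ?thesis
    unfolding sum_select_pmf by (simp add: algebra_simps)
qed

lemma prob_uncoupled_le:
  assumes z: "z \<in> Sym n \<times> Sym n"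
    and weights: "\<And>i. i \<in> {1..<n} \<Longrightarrow> contracting_weights (n - i) (r i) (c i) (w i)"
    and rate: "\<And>i. i \<in> {1..<n} \<Longrightarrow> 0 \<le> 1 - pmf (select_pmf n) i * (c i / 4)"
  shows "measure_pmf.prob (kernel_power (coupled_step n r) t z) {p. fst p \<noteq> snd p}
    \<le> (\<Sum>i\<in>{1..<n}. (1 - pmf (select_pmf n) i * (c i / 4)) ^ t * coord_dist n i (w i) z)"
proof (rule pair.prob_kernel_power_le_sum[OF z])
  fix p assume "p \<in> (Sym n \<times> Sym n) \<inter> {p. fst p \<noteq> snd p}"
  then obtain i where i: "i \<in> {1..<n}" "inv_table n (inv (fst p)) i \<noteq> inv_table n (inv (snd p)) i"
    using Sym_eqI[of "fst p" n "snd p"] by fastforce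
  then have "1 \<le> coord_dist n i (w i) p"
    unfolding coord_dist_def
    by (intro contracting_weights.potential_diff_ge_1[OF weights] inv_table_le)
  then show "\<exists>i\<in>{1..<n}. 1 \<le> coord_dist n i (w i) p"
    using i(1) by blast
qed (blast intro: rate coord_dist_nonneg expectation_coord_dist_le weights)+

lemma tv_le_sum_potential:
  assumes weights: "\<And>i. i \<in> {1..<n} \<Longrightarrow> contracting_weights (n - i) (r i) (c i) (w i)"
  shows "tv t \<le> (\<Sum>i\<in>{1..<n}.
    exp (- (pmf (select_pmf n) i * (c i / 4) * real t)) * potential (w i) (n - i))"
proof (rule tv_le_prob_uncoupled)
  let ?a = "\<lambda>i. pmf (select_pmf n) i * (c i / 4)"
  fix z assume z: "z \<in> Sym n \<times> Sym n"
  have rate: "0 \<le> 1 - ?a i" if i: "i \<in> {1..<n}" for i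
  proof -
    have "?a i \<le> pmf (select_pmf n) i * 1"
      using contracting_weights.rate_le_1[OF weights[OF i]] i by (intro mult_left_mono) auto
    also have "\<dots> \<le> 1"
      by (simp add: pmf_le_1)
    finally show ?thesis
      by simp
  qed
  have "measure_pmf.prob (kernel_power (coupled_step n r) t z) {p. fst p \<noteq> snd p}
      \<le> (\<Sum>i\<in>{1..<n}. (1 - ?a i) ^ t * coord_dist n i (w i) z)"
    by (intro prob_uncoupled_le z weights rate)
  also have "\<dots> \<le> (\<Sum>i\<in>{1..<n}. exp (- (?a i * real t)) * potential (w i) (n - i))"
  proof (intro sum_mono mult_mono coord_dist_nonneg)
    fix i assume i: "i \<in> {1..<n}"
    have "(1 - ?a i) ^ t \<le> exp (- ?a i) ^ t"
      using exp_ge_add_one_self[of "- ?a i"] rate[OF i] by (intro power_mono) auto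
    then show "(1 - ?a i) ^ t \<le> exp (- (?a i * real t))"
      by (simp add: exp_of_nat_mult[symmetric] mult.commute)
    show "coord_dist n i (w i) z \<le> potential (w i) (n - i)"
      unfolding coord_dist_def
      by (intro contracting_weights.potential_diff_le[OF weights[OF i]] inv_table_le)
  qed simp
  finally show "measure_pmf.prob (kernel_power (coupled_step n r) t z) {p. fst p \<noteq> snd p}
      \<le> (\<Sum>i\<in>{1..<n}. exp (- (?a i * real t)) * potential (w i) (n - i))" .
qed

lemma tv_le_eps:
  assumes weights: "\<And>i. i \<in> {1..<n} \<Longrightarrow> contracting_weights (n - i) (r i) (c i) (w i)"
    and "0 < \<epsilon>" and potential: "\<And>i. i \<in> {1..<n} \<Longrightarrow> potential (w i) (n - i) \<le> exp (h i)"
    and time: "\<And>i. i \<in> {1..<n} \<Longrightarrow> h i + ln (real n / \<epsilon>) \<le> pmf (select_pmf n) i * (c i / 4) * real t"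
  shows "tv t \<le> \<epsilon>"
proof -
  let ?a = "\<lambda>i. pmf (select_pmf n) i * (c i / 4) * real t"
  have "tv t \<le> (\<Sum>i\<in>{1..<n}. exp (- ?a i) * potential (w i) (n - i))"
    by (rule tv_le_sum_potential[OF weights])
  also have "\<dots> \<le> (\<Sum>i\<in>{1..<n}. \<epsilon> / real n)"
  proof (rule sum_mono)
    fix i assume i: "i \<in> {1..<n}"
    have "exp (- ?a i) * potential (w i) (n - i) \<le> exp (- ?a i) * exp (h i)"
      using potential[OF i] by (rule mult_left_mono) simp
    also have "\<dots> \<le> exp (- ln (real n / \<epsilon>))"
      using time[OF i] by (simp flip: exp_add)
    also have "\<dots> = \<epsilon> / real n"
      using n_ge_2 \<open>0 < \<epsilon>\<close> by (simp add: exp_minus)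
    finally show "exp (- ?a i) * potential (w i) (n - i) \<le> \<epsilon> / real n" .
  qed
  also have "\<dots> \<le> \<epsilon>"
    using n_ge_2 \<open>0 < \<epsilon>\<close> by (simp add: field_simps)
  finally show ?thesis .
qed

end

section \<open>Mixing time bounds\<close>

lemma geometric_contracting_weights:
  assumes "0 < \<delta>" "1 / 2 + \<delta> \<le> q" "q \<le> 1"
  shows "contracting_weights m q (\<delta> ^ 2) (\<lambda>k. (1 + \<delta>) ^ k)"
proof
  fix k
  \<comment> \<open>The factor is decreasing in \<open>q\<close>, so the worst case is \<open>q = 1 / 2 + \<delta>\<close>.\<close>
  have "q + (1 - q) * (1 + \<delta>) ^ 2 = 1 + (1 - q) * (2 * \<delta> + \<delta> ^ 2)"
    by (simp add: power2_eq_square algebra_simps)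
  also have "\<dots> \<le> 1 + (1 / 2 - \<delta>) * (2 * \<delta> + \<delta> ^ 2)"
    using assms by (intro add_left_mono mult_right_mono) auto
  also have "\<dots> \<le> (1 - \<delta> ^ 2) * (1 + \<delta>)"
    using assms by (simp add: power2_eq_square algebra_simps)
  finally have "(q + (1 - q) * (1 + \<delta>) ^ 2) * (1 + \<delta>) ^ k \<le> (1 - \<delta> ^ 2) * (1 + \<delta>) * (1 + \<delta>) ^ k"
    using assms by (intro mult_right_mono) auto
  then show "q * (1 + \<delta>) ^ k + (1 - q) * (1 + \<delta>) ^ Suc (Suc k) \<le> (1 - \<delta> ^ 2) * (1 + \<delta>) ^ Suc k"
    by (simp add: power2_eq_square algebra_simps)
  show "1 \<le> (1 + \<delta>) ^ Suc k"
    using assms by (intro one_le_power) auto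
qed (use assms in auto)

lemma potential_geometric_le:
  assumes "0 \<le> \<delta>"
  shows "potential (\<lambda>k. (1 + \<delta>) ^ k) m \<le> real m * exp (\<delta> * real m)"
proof -
  have "(1 + \<delta>) ^ k \<le> exp (\<delta> * real m)" if "k \<in> {1..m}" for k
  proof -
    have "(1 + \<delta>) ^ k \<le> (1 + \<delta>) ^ m"
      using that assms by (intro power_increasing) auto
    also have "\<dots> \<le> exp \<delta> ^ m"
      using assms by (intro power_mono) auto
    finally show ?thesis
      by (simp add: exp_of_nat_mult[symmetric] mult.commute)
  qed
  then show ?thesis
    unfolding potential_def using sum_bounded_above[of "{1..m}" _ "exp (\<delta> * real m)"] by simp
qed

text \<open>The quadratic has second difference \<open>-2\<close>, vanishes at \<open>k = 0\<close> and increases up to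
  \<open>k = m + 1\<close>.\<close>

definition quadratic_weight :: "nat \<Rightarrow> nat \<Rightarrow> real" where
  "quadratic_weight m k = real k * (2 * (real m + 1) - real k)"

lemma quadratic_weight_le: "quadratic_weight m k \<le> (real m + 1) ^ 2"
  using zero_le_power2[of "real m + 1 - real k"]
  by (simp add: quadratic_weight_def power2_eq_square algebra_simps)

lemma quadratic_contracting_weights:
  assumes "1 / 2 \<le> q" "q \<le> 1"
  shows "contracting_weights m q (1 / (real m + 1) ^ 2) (quadratic_weight m)"
proof
  let ?w = "quadratic_weight m"
  fix k assume "k < m"
  then have k: "real k + 1 \<le> real m"
    by simp
  have "?w (Suc (Suc k)) - ?w k = 4 * (real m - real k)"
    by (simp add: quadratic_weight_def algebra_simps)
  then have "0 \<le> (q - 1 / 2) * (?w (Suc (Suc k)) - ?w k)"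
    using assms k by simp
  moreover have "q * ?w k + (1 - q) * ?w (Suc (Suc k))
      = (?w k + ?w (Suc (Suc k))) / 2 - (q - 1 / 2) * (?w (Suc (Suc k)) - ?w k)"
    by (simp add: field_simps)
  moreover have "(?w k + ?w (Suc (Suc k))) / 2 = ?w (Suc k) - 1"
    by (simp add: quadratic_weight_def field_simps)
  moreover have "1 / (real m + 1) ^ 2 * ?w (Suc k) \<le> 1"
    using quadratic_weight_le[of m "Suc k"] by (simp add: divide_le_eq)
  ultimately show "q * ?w k + (1 - q) * ?w (Suc (Suc k)) \<le> (1 - 1 / (real m + 1) ^ 2) * ?w (Suc k)"
    unfolding left_diff_distrib by linarith
  have "1 * 1 \<le> (real k + 1) * (2 * (real m + 1) - (real k + 1))"
    using k by (intro mult_mono) auto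
  then show "1 \<le> ?w (Suc k)"
    by (simp add: quadratic_weight_def add_ac)
qed (use assms in \<open>auto simp: quadratic_weight_def\<close>)

lemma potential_quadratic_weight_le: "potential (quadratic_weight m) m \<le> real m * (real m + 1) ^ 2"
  unfolding potential_def
  using sum_bounded_above[of "{1..m}" "quadratic_weight m", OF quadratic_weight_le] by simp

lemma select_pmf_ge:
  assumes "2 \<le> n" "i \<in> {1..<n}"
  shows "2 * real (n - i) / real n ^ 2 \<le> pmf (select_pmf n) i"
proof -
  have "real (n choose 2) = real (n * (n - 1)) / 2"
    unfolding choose_two by (subst real_of_nat_div) auto
  then have choose: "real (n choose 2) = real n * (real n - 1) / 2"
    using assms by simp
  have "real n * (real n - 1) / 2 \<le> real n ^ 2 / 2"
    by (simp add: power2_eq_square algebra_simps)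
  then have "real (n - i) / (real n ^ 2 / 2) \<le> real (n - i) / real (n choose 2)"
    unfolding choose using assms by (intro divide_left_mono mult_pos_pos) auto
  then show ?thesis
    using assms by (simp add: pmf_select_pmf mult.commute)
qed

lemma inverse_cube_le:
  fixes m N :: real
  assumes "1 \<le> m" "m + 1 \<le> N"
  shows "1 / (4 * N ^ 3) \<le> (2 * m / N ^ 2) * (1 / (m + 1) ^ 2 / 4)"
proof -
  have "(m + 1) ^ 2 \<le> (2 * m) * N"
    unfolding power2_eq_square using assms by (intro mult_mono) auto
  then have "1 / (2 * m * N) \<le> 1 / (m + 1) ^ 2"
    using assms by (intro divide_left_mono) auto
  then have "(2 * m / N ^ 2) * (1 / (2 * m * N) / 4) \<le> (2 * m / N ^ 2) * (1 / (m + 1) ^ 2 / 4)"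
    using assms by (intro mult_left_mono divide_right_mono) auto
  moreover have "(2 * m / N ^ 2) * (1 / (2 * m * N) / 4) = 1 / (4 * N ^ 3)"
    using assms by (simp add: power2_eq_square power3_eq_cube)
  ultimately show ?thesis
    by simp
qed

context inversion_chain
begin

lemma ln_div_ge_half:
  assumes "0 < \<epsilon>" "\<epsilon> \<le> 1"
  shows "1 / 2 \<le> ln (real n / \<epsilon>)"
proof -
  have "real n / 1 \<le> real n / \<epsilon>"
    using assms by (intro divide_left_mono) auto
  then have "2 \<le> real n / \<epsilon>"
    using n_ge_2 by simp
  then have "ln 2 \<le> ln (real n / \<epsilon>)"
    by simp
  then show ?thesis
    using ln2_ge_two_thirds by simp
qed

lemma ln_le_ln_div: "\<lbrakk>0 < \<epsilon>; \<epsilon> \<le> 1\<rbrakk> \<Longrightarrow> ln (real n) \<le> ln (real n / \<epsilon>)"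
  using n_ge_2 by (simp add: field_simps)

lemma tv_le_eps_if_bias_ge:
  assumes "0 < \<delta>" and r: "\<And>i. i \<in> {1..<n} \<Longrightarrow> 1 / 2 + \<delta> \<le> r i"
    and \<epsilon>: "0 < \<epsilon>" "\<epsilon> \<le> 1" and t: "6 / \<delta> ^ 2 * real n ^ 2 * ln (real n / \<epsilon>) \<le> real t"
  shows "tv t \<le> \<epsilon>"
proof (rule tv_le_eps[where h = "\<lambda>i. \<delta> * real (n - i) + ln (real n)"])
  let ?L = "ln (real n / \<epsilon>)"
  fix i assume i: "i \<in> {1..<n}"
  define m where "m = real (n - i)"
  have m: "1 \<le> m" "m \<le> real n"
    using i by (auto simp: m_def)
  show "contracting_weights (n - i) (r i) (\<delta> ^ 2) (\<lambda>k. (1 + \<delta>) ^ k)"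
    using \<open>0 < \<delta>\<close> r[OF i] r_bounds[OF i] by (intro geometric_contracting_weights) auto
  have "potential (\<lambda>k. (1 + \<delta>) ^ k) (n - i) \<le> m * exp (\<delta> * m)"
    unfolding m_def using \<open>0 < \<delta>\<close> by (intro potential_geometric_le) simp
  also have "\<dots> \<le> real n * exp (\<delta> * m)"
    using m by (intro mult_right_mono) auto
  finally show "potential (\<lambda>k. (1 + \<delta>) ^ k) (n - i) \<le> exp (\<delta> * real (n - i) + ln (real n))"
    using n_ge_2 by (simp add: m_def exp_add mult.commute)
  have "\<delta> \<le> 1 / 2"
    using r[OF i] r_bounds[OF i] by simp
  then have "\<delta> * m \<le> ?L * m"
    using ln_div_ge_half[OF \<epsilon>] m by (intro mult_right_mono) auto
  moreover have "ln (real n) + ?L \<le> 2 * ?L * m"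
  proof -
    have "ln (real n) + ?L \<le> 2 * ?L * 1"
      using ln_le_ln_div[OF \<epsilon>] by simp
    also have "\<dots> \<le> 2 * ?L * m"
      using ln_div_ge_half[OF \<epsilon>] m by (intro mult_left_mono) auto
    finally show ?thesis .
  qed
  ultimately have "\<delta> * m + ln (real n) + ?L \<le> 3 * ?L * m"
    by simp
  also have "\<dots> = (2 * m / real n ^ 2) * (\<delta> ^ 2 / 4) * (6 / \<delta> ^ 2 * real n ^ 2 * ?L)"
    using \<open>0 < \<delta>\<close> n_ge_2 by (simp add: field_simps)
  also have "\<dots> \<le> (2 * m / real n ^ 2) * (\<delta> ^ 2 / 4) * real t"
    using m by (intro mult_left_mono t) auto
  also have "\<dots> \<le> pmf (select_pmf n) i * (\<delta> ^ 2 / 4) * real t"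
    unfolding m_def by (intro mult_right_mono select_pmf_ge n_ge_2 i) auto
  finally show "\<delta> * real (n - i) + ln (real n) + ?L \<le> pmf (select_pmf n) i * (\<delta> ^ 2 / 4) * real t"
    by (simp add: m_def)
qed (use \<epsilon> in simp)

lemma tv_le_eps_if_bias_nonneg:
  assumes r: "\<And>i. i \<in> {1..<n} \<Longrightarrow> 1 / 2 \<le> r i"
    and \<epsilon>: "0 < \<epsilon>" "\<epsilon> \<le> 1" and t: "16 * real n ^ 3 * ln (real n / \<epsilon>) \<le> real t"
  shows "tv t \<le> \<epsilon>"
proof (rule tv_le_eps[where h = "\<lambda>i. 3 * ln (real n)"])
  let ?L = "ln (real n / \<epsilon>)"
  fix i assume i: "i \<in> {1..<n}"
  let ?w = "quadratic_weight (n - i)"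
  define m where "m = real (n - i)"
  have m: "1 \<le> m" "m + 1 \<le> real n"
    using i by (auto simp: m_def)
  show "contracting_weights (n - i) (r i) (1 / (real (n - i) + 1) ^ 2) ?w"
    using r[OF i] r_bounds[OF i] by (intro quadratic_contracting_weights) auto
  have "potential ?w (n - i) \<le> m * (m + 1) ^ 2"
    unfolding m_def by (rule potential_quadratic_weight_le)
  also have "\<dots> \<le> real n * real n ^ 2"
    using m by (intro mult_mono power_mono) auto
  also have "\<dots> = exp (real 3 * ln (real n))"
    unfolding exp_of_nat_mult using n_ge_2 by (simp add: power2_eq_square power3_eq_cube)
  finally show "potential ?w (n - i) \<le> exp (3 * ln (real n))"
    by simp
  have "3 * ln (real n) + ?L \<le> 4 * ?L"
    using ln_le_ln_div[OF \<epsilon>] by simp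
  also have "\<dots> = 1 / (4 * real n ^ 3) * (16 * real n ^ 3 * ?L)"
    using n_ge_2 by simp
  also have "\<dots> \<le> 1 / (4 * real n ^ 3) * real t"
    by (intro mult_left_mono t) simp
  also have "\<dots> \<le> (2 * m / real n ^ 2) * (1 / (m + 1) ^ 2 / 4) * real t"
    using m by (intro mult_right_mono inverse_cube_le) auto
  also have "\<dots> \<le> pmf (select_pmf n) i * (1 / (m + 1) ^ 2 / 4) * real t"
    unfolding m_def by (intro mult_right_mono select_pmf_ge n_ge_2 i) auto
  finally show "3 * ln (real n) + ?L
      \<le> pmf (select_pmf n) i * (1 / (real (n - i) + 1) ^ 2 / 4) * real t"
    by (simp add: m_def)
qed (use \<epsilon> in simp)

lemma tau_inv_le:
  assumes \<epsilon>: "0 < \<epsilon>" "\<epsilon> \<le> real n" and "0 \<le> C" "1 \<le> m"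
    and tv: "\<And>t. \<lbrakk>\<epsilon> \<le> 1; C * real n ^ m * ln (real n / \<epsilon>) \<le> real t\<rbrakk> \<Longrightarrow> tv t \<le> \<epsilon>"
  shows "ereal_of_enat (tau_inv n (choose_prob r) \<epsilon>)
    \<le> ereal ((C + 1) * real n ^ m * ln (real n / \<epsilon>))"
proof (cases "\<epsilon> \<le> 1")
  case True
  let ?L = "ln (real n / \<epsilon>)"
  have L: "1 / 2 \<le> ?L"
    by (rule ln_div_ge_half[OF \<epsilon>(1) True])
  have "2 \<le> real n ^ m"
    using n_ge_2 \<open>1 \<le> m\<close> by (intro order_trans[OF _ self_le_power]) auto
  then have "2 * (1 / 2) \<le> real n ^ m * ?L"
    using L by (intro mult_mono) auto
  moreover have "ereal_of_enat (tau_inv n (choose_prob r) \<epsilon>) \<le> ereal (C * real n ^ m * ?L + 1)"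
    unfolding tau_inv_def using L \<open>0 \<le> C\<close> tv[OF True] by (intro mixing_time_le_real) auto
  ultimately show ?thesis
    by (elim order_trans) (simp add: algebra_simps)
next
  case False
  have "tv t \<le> 1" for t
    by (rule tv_le_prob_uncoupled) simp
  then have "tau_inv n (choose_prob r) \<epsilon> \<le> enat 0"
    unfolding tau_inv_def using False by (intro mixing_time_le) (meson linear order_trans)
  then have "tau_inv n (choose_prob r) \<epsilon> = 0"
    by (simp flip: zero_enat_def)
  moreover have "0 \<le> ln (real n / \<epsilon>)"
    using \<epsilon> by simp
  ultimately show ?thesis
    using \<open>0 \<le> C\<close> by simp
qed

end

theorem theorem3:
  fixes \<delta> :: real
  assumes "0 < \<delta>"
  shows
    "(\<exists>C::real. \<forall>n\<ge>2. \<forall>r :: nat \<Rightarrow> real.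
        (\<forall>i\<in>{1..<n}. 1 / 2 \<le> r i \<and> r i < 1) \<longrightarrow>
        (\<forall>i\<in>{1..<n}. 1 / 2 + \<delta> \<le> r i) \<longrightarrow>
        (\<forall>\<epsilon>::real. 0 < \<epsilon> \<and> \<epsilon> \<le> real n \<longrightarrow>
          ereal_of_enat (tau_inv n (choose_prob r) \<epsilon>)
            \<le> ereal (C * real n ^ 2 * ln (real n / \<epsilon>)))) \<and>
     (\<exists>C::real. \<forall>n\<ge>2. \<forall>r :: nat \<Rightarrow> real.
        (\<forall>i\<in>{1..<n}. 1 / 2 \<le> r i \<and> r i < 1) \<longrightarrow>
        \<not> (\<forall>i\<in>{1..<n}. 1 / 2 + \<delta> \<le> r i) \<longrightarrow>
        (\<forall>\<epsilon>::real. 0 < \<epsilon> \<and> \<epsilon> \<le> real n \<longrightarrow>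
          ereal_of_enat (tau_inv n (choose_prob r) \<epsilon>)
            \<le> ereal (C * real n ^ 3 * ln (real n / \<epsilon>))))"
proof (intro conjI exI allI impI)
  fix n :: nat and r :: "nat \<Rightarrow> real" and \<epsilon> :: real
  assume n: "2 \<le> n" and r: "\<forall>i\<in>{1..<n}. 1 / 2 \<le> r i \<and> r i < 1" and \<epsilon>: "0 < \<epsilon> \<and> \<epsilon> \<le> real n"
  then interpret inversion_chain n r
    by unfold_locales force+
  show "ereal_of_enat (tau_inv n (choose_prob r) \<epsilon>)
      \<le> ereal ((16 + 1) * real n ^ 3 * ln (real n / \<epsilon>))"
    using r \<epsilon> by (intro tau_inv_le tv_le_eps_if_bias_nonneg) auto
  assume "\<forall>i\<in>{1..<n}. 1 / 2 + \<delta> \<le> r i"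
  then show "ereal_of_enat (tau_inv n (choose_prob r) \<epsilon>)
      \<le> ereal ((6 / \<delta> ^ 2 + 1) * real n ^ 2 * ln (real n / \<epsilon>))"
    using \<epsilon> \<open>0 < \<delta>\<close> by (intro tau_inv_le tv_le_eps_if_bias_ge[of \<delta>]) auto
qed

end
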